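(* Let $R\subset S$ be an unramified Gilmer extension whose nucleus $R/(R:S)$ is reduced. Then $R\subset S$ is finite and has FIP.
   Context: Rings are commutative with identity. $(R:S)=\{r\in R\mid rS\subseteq R\}$, the nucleus is $R/(R:S)$, and $R\subset S$ is a Gilmer extension if the nucleus is Artinian. Unramified: $S$ of finite type over $R$ with $\Omega(S|R)=0$. FIP: finitely many $R$-subalgebras of $S$. *)

theory Defs
  imports "HOL-Algebra.QuotRing"
begin

text \<open>Ambient ring S is the whole type 'a (a commutative ring with 1);
  R is a subring of S (contains 0 and 1, closed under +, -, *).\<close>

definition is_subring :: "'a::comm_ring_1 set \<Rightarrow> bool" where
  "is_subring R \<longleftrightarrow> 0 \<in> R \<and> 1 \<in> R \<and>
     (\<forall>x\<in>R. \<forall>y\<in>R. x + y \<in> R \<and> x - y \<in> R \<and> x * y \<in> R)"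

definition ring_of :: "'a::comm_ring_1 set \<Rightarrow> 'a ring" where
  "ring_of R = \<lparr>carrier = R, monoid.mult = (*), one = 1, zero = 0, add = (+)\<rparr>"

definition conductor :: "'a::comm_ring_1 set \<Rightarrow> 'a set" where
  "conductor R = {r \<in> R. \<forall>s. r * s \<in> R}"

definition nucleus :: "'a::comm_ring_1 set \<Rightarrow> 'a set ring" where
  "nucleus R = ring_of R Quot conductor R"

definition artinian :: "('b, 'c) ring_scheme \<Rightarrow> bool" where
  "artinian A \<longleftrightarrow> ring A \<and>
     (\<forall>I :: nat \<Rightarrow> 'b set. (\<forall>n. ideal (I n) A \<and> I (Suc n) \<subseteq> I n) \<longrightarrow>
        (\<exists>N. \<forall>n\<ge>N. I n = I N))"

definition reduced :: "('b, 'c) ring_scheme \<Rightarrow> bool" where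
  "reduced A \<longleftrightarrow> (\<forall>x\<in>carrier A. \<forall>n::nat. x [^]\<^bsub>A\<^esub> n = \<zero>\<^bsub>A\<^esub> \<longrightarrow> x = \<zero>\<^bsub>A\<^esub>)"

definition gilmer_ext :: "'a::comm_ring_1 set \<Rightarrow> bool" where
  "gilmer_ext R \<longleftrightarrow> artinian (nucleus R)"

inductive_set alg_gen :: "'a::comm_ring_1 set \<Rightarrow> 'a set \<Rightarrow> 'a set" for R F where
  base: "r \<in> R \<Longrightarrow> r \<in> alg_gen R F"
| gen: "x \<in> F \<Longrightarrow> x \<in> alg_gen R F"
| add: "x \<in> alg_gen R F \<Longrightarrow> y \<in> alg_gen R F \<Longrightarrow> x + y \<in> alg_gen R F"
| neg: "x \<in> alg_gen R F \<Longrightarrow> - x \<in> alg_gen R F"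
| mult: "x \<in> alg_gen R F \<Longrightarrow> y \<in> alg_gen R F \<Longrightarrow> x * y \<in> alg_gen R F"

definition finite_type :: "'a::comm_ring_1 set \<Rightarrow> bool" where
  "finite_type R \<longleftrightarrow> (\<exists>F. finite F \<and> alg_gen R F = UNIV)"

text \<open>Kaehler differentials Omega(S|R): the free S-module on symbols d s (s in S),
  modelled as finitely supported functions 'a \<Rightarrow> 'a, modulo the S-submodule
  generated by the relations d(s+t) - ds - dt, d(st) - s dt - t ds, and dr (r in R).
  Omega(S|R) = 0 iff every generator d s lies in that submodule.\<close>

definition dsym :: "'a::comm_ring_1 \<Rightarrow> 'a \<Rightarrow> 'a" where
  "dsym s = (\<lambda>x. if x = s then 1 else 0)"

inductive_set kaehler_rel :: "'a::comm_ring_1 set \<Rightarrow> ('a \<Rightarrow> 'a) set" for R where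
  zero: "(\<lambda>_. 0) \<in> kaehler_rel R"
| rel_add: "(\<lambda>x. dsym (s + t) x - dsym s x - dsym t x) \<in> kaehler_rel R"
| rel_mult: "(\<lambda>x. dsym (s * t) x - s * dsym t x - t * dsym s x) \<in> kaehler_rel R"
| rel_const: "r \<in> R \<Longrightarrow> dsym r \<in> kaehler_rel R"
| sum: "f \<in> kaehler_rel R \<Longrightarrow> g \<in> kaehler_rel R \<Longrightarrow> (\<lambda>x. f x + g x) \<in> kaehler_rel R"
| smult: "f \<in> kaehler_rel R \<Longrightarrow> (\<lambda>x. c * f x) \<in> kaehler_rel R"

definition kaehler_zero :: "'a::comm_ring_1 set \<Rightarrow> bool" where
  "kaehler_zero R \<longleftrightarrow> (\<forall>s. dsym s \<in> kaehler_rel R)"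

definition unramified :: "'a::comm_ring_1 set \<Rightarrow> bool" where
  "unramified R \<longleftrightarrow> finite_type R \<and> kaehler_zero R"

definition finite_ext :: "'a::comm_ring_1 set \<Rightarrow> bool" where
  "finite_ext R \<longleftrightarrow> (\<exists>F. finite F \<and>
     (\<forall>s. \<exists>c. (\<forall>f\<in>F. c f \<in> R) \<and> s = (\<Sum>f\<in>F. c f * f)))"

definition FIP :: "'a::comm_ring_1 set \<Rightarrow> bool" where
  "FIP R \<longleftrightarrow> finite {T. is_subring T \<and> R \<subseteq> T}"

end

theory Submission
  imports Defs "HOL-Library.Poly_Mapping"
begin

text \<open>
  Write \<open>C = (R : S)\<close>. Since \<open>R/C\<close> is Artinian and reduced, each of its ideals is generated by an
  idempotent, so submodules of \<open>R/C\<close>-modules are direct summands. In \<open>S/C \<otimes>\<^sub>R S/C\<close> the diagonal ideal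
  \<open>J\<close> is finitely generated because \<open>S\<close> is of finite type, and \<open>J = J\<^sup>2\<close> because \<open>\<Omega>(S|R) = 0\<close>; by
  Nakayama there is a separability element \<open>\<epsilon> = \<Sum> x\<^sub>i \<otimes> y\<^sub>i\<close> with \<open>\<epsilon>J = 0\<close> and \<open>\<Sum> x\<^sub>i y\<^sub>i = 1\<close>.

  If \<open>p\<close> is an \<open>R\<close>-linear projection of \<open>S/C\<close> onto the span of the \<open>y\<^sub>i\<close>, then
  \<open>s = \<Sum> s x\<^sub>i p(y\<^sub>i) = \<Sum> x\<^sub>i p(s y\<^sub>i)\<close>, so the products \<open>x\<^sub>i y\<^sub>j\<close> generate \<open>S/C\<close>.

  Averaging \<open>R\<close>-linear projections with \<open>\<epsilon>\<close> on both sides (Maschke) shows that every ideal of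
  \<open>S/C \<otimes>\<^sub>R S/C\<close> is generated by an idempotent, hence there are only finitely many. An intermediate
  ring \<open>T\<close> is recovered from the kernel of \<open>S/C \<otimes>\<^sub>R S/C \<rightarrow> S/C \<otimes>\<^sub>T S/C\<close> as the set of \<open>b\<close> with
  \<open>b \<otimes> 1 = 1 \<otimes> b\<close>, because \<open>T/C\<close> is again Artinian and reduced and so is a \<open>T\<close>-linear direct
  summand of \<open>S/C\<close>.
\<close>

section \<open>Submodules over a subring\<close>

definition submod :: "'a::comm_ring_1 set \<Rightarrow> 'a set \<Rightarrow> bool" where
  "submod A V \<longleftrightarrow> 0 \<in> V \<and> (\<forall>x\<in>V. \<forall>y\<in>V. x + y \<in> V) \<and> (\<forall>a\<in>A. \<forall>x\<in>V. a * x \<in> V)"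

definition mspan :: "'a::comm_ring_1 set \<Rightarrow> 'a set \<Rightarrow> 'a set" where
  "mspan A X = \<Inter>{V. submod A V \<and> X \<subseteq> V}"

lemma is_subring_UNIV: "is_subring UNIV"
  by (simp add: is_subring_def)

lemma subring_uminus: "is_subring A \<Longrightarrow> x \<in> A \<Longrightarrow> - x \<in> A"
  unfolding is_subring_def by (metis diff_0)

lemma subring_power: "is_subring A \<Longrightarrow> x \<in> A \<Longrightarrow> x ^ n \<in> A"
  by (induction n) (auto simp: is_subring_def)

lemma submod_0: "submod A V \<Longrightarrow> 0 \<in> V"
  and submod_add: "submod A V \<Longrightarrow> x \<in> V \<Longrightarrow> y \<in> V \<Longrightarrow> x + y \<in> V"
  and submod_mult: "submod A V \<Longrightarrow> a \<in> A \<Longrightarrow> x \<in> V \<Longrightarrow> a * x \<in> V"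
  by (auto simp: submod_def)

lemma submod_uminus: "is_subring A \<Longrightarrow> submod A V \<Longrightarrow> x \<in> V \<Longrightarrow> - x \<in> V"
  using submod_mult[of A V "-1" x] subring_uminus[of A 1] by (simp add: is_subring_def)

lemma submod_diff: "is_subring A \<Longrightarrow> submod A V \<Longrightarrow> x \<in> V \<Longrightarrow> y \<in> V \<Longrightarrow> x - y \<in> V"
  using submod_add[of A V x "- y"] submod_uminus[of A V y] by simp

lemma submod_sum: "submod A V \<Longrightarrow> (\<And>i. i \<in> I \<Longrightarrow> f i \<in> V) \<Longrightarrow> sum f I \<in> V"
  by (induction I rule: infinite_finite_induct) (auto simp: submod_0 submod_add)

lemma ideal_uminus: "submod UNIV V \<Longrightarrow> x \<in> V \<Longrightarrow> - x \<in> V"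
  by (rule submod_uminus[OF is_subring_UNIV])

lemma ideal_diff: "submod UNIV V \<Longrightarrow> x \<in> V \<Longrightarrow> y \<in> V \<Longrightarrow> x - y \<in> V"
  by (rule submod_diff[OF is_subring_UNIV])

lemma ideal_mult: "submod UNIV V \<Longrightarrow> x \<in> V \<Longrightarrow> a * x \<in> V"
  by (simp add: submod_mult)

lemma ideal_mult_right: "submod UNIV V \<Longrightarrow> x \<in> V \<Longrightarrow> x * a \<in> V"
  by (metis ideal_mult mult.commute)

lemma submod_subset: "submod B V \<Longrightarrow> A \<subseteq> B \<Longrightarrow> submod A V"
  by (auto simp: submod_def)

lemma subring_submod: "is_subring A \<Longrightarrow> submod A A"
  by (auto simp: submod_def is_subring_def)

lemma submod_plus:
  assumes "submod A V" "submod A W"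
  shows "submod A {v + w |v w. v \<in> V \<and> w \<in> W}"
  unfolding submod_def
proof (intro conjI ballI)
  show "0 \<in> {v + w |v w. v \<in> V \<and> w \<in> W}"
    using assms[THEN submod_0] by force
next
  fix x y assume "x \<in> {v + w |v w. v \<in> V \<and> w \<in> W}" "y \<in> {v + w |v w. v \<in> V \<and> w \<in> W}"
  then obtain v w v' w' where *: "v \<in> V" "w \<in> W" "v' \<in> V" "w' \<in> W" "x = v + w" "y = v' + w'"
    by auto
  then have "x + y = (v + v') + (w + w')" by (simp add: algebra_simps)
  with * assms show "x + y \<in> {v + w |v w. v \<in> V \<and> w \<in> W}"
    by (blast intro: submod_add)
next
  fix a x assume "a \<in> A" "x \<in> {v + w |v w. v \<in> V \<and> w \<in> W}"
  then obtain v w where "v \<in> V" "w \<in> W" "x = v + w" by auto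
  then show "a * x \<in> {v + w |v w. v \<in> V \<and> w \<in> W}"
    using assms \<open>a \<in> A\<close> by (force simp: distrib_left intro: submod_mult)
qed

lemma submod_Int: "submod A V \<Longrightarrow> submod A W \<Longrightarrow> submod A (V \<inter> W)"
  by (auto simp: submod_def)

lemma submod_multiples:
  assumes "is_subring A" shows "submod A {a * x |a. a \<in> A}"
  unfolding submod_def
proof (intro conjI ballI)
  show "0 \<in> {a * x |a. a \<in> A}" using assms by (auto simp: is_subring_def intro!: exI[of _ 0])
next
  fix y z assume "y \<in> {a * x |a. a \<in> A}" "z \<in> {a * x |a. a \<in> A}"
  then show "y + z \<in> {a * x |a. a \<in> A}"
    using assms by (auto simp: is_subring_def distrib_right[symmetric])
next
  fix b y assume "b \<in> A" "y \<in> {a * x |a. a \<in> A}"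
  then show "b * y \<in> {a * x |a. a \<in> A}"
    using assms by (auto simp: is_subring_def mult.assoc[symmetric])
qed

lemma submod_mspan: "submod A (mspan A X)"
  by (auto simp: submod_def mspan_def)

lemma mspan_superset: "X \<subseteq> mspan A X"
  by (auto simp: mspan_def)

lemma mspan_base: "x \<in> X \<Longrightarrow> x \<in> mspan A X"
  using mspan_superset by blast

lemma mspan_minimal: "submod A V \<Longrightarrow> X \<subseteq> V \<Longrightarrow> mspan A X \<subseteq> V"
  by (auto simp: mspan_def)

lemma mspan_mono: "X \<subseteq> Y \<Longrightarrow> mspan A X \<subseteq> mspan A Y"
  by (auto simp: mspan_def)

text \<open>Peels one generator off a span; both the Nakayama argument and the descending chain
  condition for finitely generated modules induct this way.\<close>

lemma mspan_insert:
  assumes "is_subring A" "m \<in> mspan A (insert f X)"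
  obtains a m' where "a \<in> A" "m' \<in> mspan A X" "m = a * f + m'"
proof -
  let ?V = "{v + w |v w. v \<in> {a * f |a. a \<in> A} \<and> w \<in> mspan A X}"
  have "submod A ?V"
    by (intro submod_plus submod_multiples submod_mspan assms)
  moreover have "insert f X \<subseteq> ?V"
  proof -
    have "f = 1 * f + 0" "1 \<in> A" "0 \<in> A" using assms(1) by (auto simp: is_subring_def)
    then have "f \<in> ?V" using submod_0[OF submod_mspan, of A X] by blast
    moreover have "x \<in> ?V" if "x \<in> X" for x
    proof -
      have "x = 0 * f + x" by simp
      then show ?thesis using \<open>0 \<in> A\<close> mspan_base[OF that, of A] by blast
    qed
    ultimately show ?thesis by blast
  qed
  ultimately have "m \<in> ?V" by (rule subsetD[OF mspan_minimal assms(2)])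
  then show ?thesis using that by blast
qed

lemma submod_Union_chain:
  assumes "\<C> \<noteq> {}" "subset.chain \<A> \<C>" "\<And>V. V \<in> \<A> \<Longrightarrow> submod A V"
  shows "submod A (\<Union>\<C>)"
  unfolding submod_def
proof (intro conjI ballI)
  have sub: "\<And>V. V \<in> \<C> \<Longrightarrow> submod A V" and lin: "\<And>V W. V \<in> \<C> \<Longrightarrow> W \<in> \<C> \<Longrightarrow> V \<subseteq> W \<or> W \<subseteq> V"
    using assms unfolding subset.chain_def by (blast, blast)
  show "0 \<in> \<Union>\<C>" using assms(1) sub submod_0 by blast
  show "x + y \<in> \<Union>\<C>" if xy: "x \<in> \<Union>\<C>" "y \<in> \<Union>\<C>" for x y
  proof -
    obtain V W where "V \<in> \<C>" "W \<in> \<C>" "x \<in> V" "y \<in> W" using xy by blast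
    then show ?thesis using lin[of V W] sub submod_add by blast
  qed
  show "a * x \<in> \<Union>\<C>" if "a \<in> A" "x \<in> \<Union>\<C>" for a x
    using that sub submod_mult by blast
qed

section \<open>Congruence modulo an ideal\<close>

definition cong_mod :: "'a::comm_ring_1 set \<Rightarrow> 'a \<Rightarrow> 'a \<Rightarrow> bool" where
  "cong_mod N x y \<longleftrightarrow> x - y \<in> N"

lemma cong_mod_refl: "submod UNIV N \<Longrightarrow> cong_mod N x x"
  by (simp add: cong_mod_def submod_0)

lemma cong_mod_sym: "submod UNIV N \<Longrightarrow> cong_mod N x y \<Longrightarrow> cong_mod N y x"
  unfolding cong_mod_def using ideal_uminus[of N "x - y"] by simp

lemma cong_mod_trans: "submod UNIV N \<Longrightarrow> cong_mod N x y \<Longrightarrow> cong_mod N y z \<Longrightarrow> cong_mod N x z"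
  unfolding cong_mod_def using submod_add[of UNIV N "x - y" "y - z"] by simp

lemma cong_mod_add:
  "submod UNIV N \<Longrightarrow> cong_mod N x y \<Longrightarrow> cong_mod N x' y' \<Longrightarrow> cong_mod N (x + x') (y + y')"
  unfolding cong_mod_def using submod_add[of UNIV N "x - y" "x' - y'"] by (simp add: algebra_simps)

lemma cong_mod_sum:
  "submod UNIV N \<Longrightarrow> (\<And>i. i \<in> I \<Longrightarrow> cong_mod N (f i) (g i)) \<Longrightarrow> cong_mod N (sum f I) (sum g I)"
  unfolding cong_mod_def sum_subtractf[symmetric] by (rule submod_sum)

lemma cong_mod_mult:
  assumes "submod UNIV N" "cong_mod N x y" "cong_mod N x' y'"
  shows "cong_mod N (x * x') (y * y')"
proof -
  have "x * x' - y * y' = x' * (x - y) + y * (x' - y')" by (simp add: algebra_simps)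
  then show ?thesis
    using assms unfolding cong_mod_def by (simp add: ideal_mult submod_add)
qed

lemma cong_mod_mult_left: "submod UNIV N \<Longrightarrow> cong_mod N x y \<Longrightarrow> cong_mod N (a * x) (a * y)"
  by (simp add: cong_mod_mult cong_mod_refl)

lemma cong_mod_mem: "submod UNIV N \<Longrightarrow> submod A V \<Longrightarrow> N \<subseteq> V \<Longrightarrow> cong_mod N x y \<Longrightarrow> y \<in> V \<Longrightarrow> x \<in> V"
  unfolding cong_mod_def using submod_add[of A V "x - y" y] by auto

section \<open>Semisimplicity modulo an ideal\<close>

text \<open>Every ideal of \<open>A/(A \<inter> N)\<close> is generated by an idempotent.\<close>

definition regular_mod :: "'a::comm_ring_1 set \<Rightarrow> 'a set \<Rightarrow> bool" where
  "regular_mod A N \<longleftrightarrow>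
    (\<forall>I. submod A I \<longrightarrow> I \<subseteq> A \<longrightarrow> N \<inter> A \<subseteq> I \<longrightarrow> (\<exists>e\<in>I. \<forall>x\<in>I. x - e * x \<in> N))"

text \<open>Semisimplicity of modules over \<open>A/(A \<inter> N)\<close>: Zorn gives
  \<open>U\<close> maximal among the submodules meeting \<open>Y\<close> exactly in
  \<open>N\<close>. If some \<open>s\<close> lay outside \<open>U + Y\<close>, a suitable multiple
  of \<open>s\<close> could still be added to \<open>U\<close>.\<close>

lemma submod_complement:
  assumes A: "is_subring A" and N: "submod UNIV N" and reg: "regular_mod A N"
    and Y: "submod A Y" and NY: "N \<subseteq> Y"
  obtains U where "submod A U" "N \<subseteq> U" "U \<inter> Y = N" "\<And>s. \<exists>u\<in>U. \<exists>y\<in>Y. s = u + y"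
proof -
  let ?\<A> = "{U. submod A U \<and> N \<subseteq> U \<and> U \<inter> Y = N}"
  have NA: "submod A N" using N submod_subset by blast
  have "\<exists>U\<in>?\<A>. \<forall>X\<in>?\<A>. U \<subseteq> X \<longrightarrow> X = U"
  proof (rule subset_Zorn_nonempty)
    show "?\<A> \<noteq> {}" using NA NY by blast
    show "\<Union>\<C> \<in> ?\<A>" if "\<C> \<noteq> {}" "subset.chain ?\<A> \<C>" for \<C>
    proof -
      have "submod A (\<Union>\<C>)" by (rule submod_Union_chain[OF that]) simp
      moreover have "N \<subseteq> \<Union>\<C>" "\<Union>\<C> \<inter> Y = N"
        using that by (auto simp: subset.chain_def)
      ultimately show ?thesis by blast
    qed
  qed
  then obtain U where U: "submod A U" "N \<subseteq> U" "U \<inter> Y = N"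
    and max: "\<And>X. submod A X \<Longrightarrow> N \<subseteq> X \<Longrightarrow> X \<inter> Y = N \<Longrightarrow> U \<subseteq> X \<Longrightarrow> X = U"
    by (smt (verit) mem_Collect_eq)
  let ?W = "{u + y |u y. u \<in> U \<and> y \<in> Y}"
  have W: "submod A ?W" by (rule submod_plus[OF U(1) Y])
  have UW: "U \<subseteq> ?W" using submod_0[OF Y] by force
  have YW: "Y \<subseteq> ?W" using submod_0[OF U(1)] by force
  have sW: "s \<in> ?W" for s
  proof (rule ccontr)
    assume s: "s \<notin> ?W"
    \<comment> \<open>The multipliers carrying \<open>s\<close> into \<open>?W\<close> form an
      ideal, so it has a generator \<open>e\<close> that is idempotent modulo
      \<open>N\<close>.\<close>
    let ?I = "{a \<in> A. a * s \<in> ?W}"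
    have "submod A ?I"
      unfolding submod_def
    proof (intro conjI ballI)
      show "0 \<in> ?I" using submod_0[OF W] A by (simp add: is_subring_def)
      show "x + y \<in> ?I" if "x \<in> ?I" "y \<in> ?I" for x y
        using that submod_add[OF W, of "x * s" "y * s"] A
        by (auto simp: is_subring_def distrib_right)
      show "a * x \<in> ?I" if "a \<in> A" "x \<in> ?I" for a x
        using that submod_mult[OF W, of a "x * s"] A
        by (auto simp: is_subring_def mult.assoc)
    qed
    moreover have "N \<inter> A \<subseteq> ?I" using ideal_mult_right[OF N] U(2) UW by blast
    ultimately obtain e where e: "e \<in> ?I" and ee: "\<And>x. x \<in> ?I \<Longrightarrow> x - e * x \<in> N"
      using reg unfolding regular_mod_def by (metis (no_types, lifting) mem_Collect_eq subsetI)
    \<comment> \<open>Removing the part \<open>e * s\<close>, which lies in \<open>?W\<close>,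
      leaves an element whose multiples meet \<open>?W\<close> only in \<open>N\<close>. Hence
      adding \<open>v\<close> to \<open>U\<close> creates no new intersection with
      \<open>Y\<close>.\<close>
    define v where "v = s - e * s"
    have vW: "v \<notin> ?W"
    proof
      assume "v \<in> ?W"
      then have "v + e * s \<in> ?W" using submod_add[OF W] e by blast
      then show False using s by (simp add: v_def)
    qed
    let ?X = "{u + w |u w. u \<in> U \<and> w \<in> {a * v |a. a \<in> A}}"
    have X: "submod A ?X" by (intro submod_plus U submod_multiples A)
    have UX: "U \<subseteq> ?X" using submod_0[OF submod_multiples[OF A]] by force
    have "?X \<inter> Y \<subseteq> N"
    proof
      fix x assume "x \<in> ?X \<inter> Y"
      then obtain u a where ua: "u \<in> U" "a \<in> A" "x = u + a * v" "x \<in> Y" by blast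
      have "x - u \<in> ?W"
        by (rule submod_diff[OF A W subsetD[OF YW ua(4)] subsetD[OF UW ua(1)]])
      moreover have "a * v = x - u" using ua by simp
      ultimately have "a * v \<in> ?W" by simp
      then have "a * s - a * (e * s) \<in> ?W" by (simp add: v_def right_diff_distrib)
      then have "(a - e * a) * s \<in> ?W" by (simp add: algebra_simps)
      moreover have "a - e * a \<in> A" using ua e A by (auto simp: is_subring_def)
      ultimately have "(a - e * a) - e * (a - e * a) \<in> N" using ee by blast
      moreover have "e * e - e \<in> N" using ee[OF e] ideal_uminus[OF N] by force
      then have "a * (e * e - e) \<in> N" by (rule ideal_mult[OF N])
      ultimately have "((a - e * a) - e * (a - e * a)) - a * (e * e - e) \<in> N"
        by (rule ideal_diff[OF N])
      then have "a - e * a \<in> N" by (simp add: algebra_simps)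
      then have "(a - e * a) * s \<in> N" by (rule ideal_mult_right[OF N])
      then have "a * v \<in> N" by (simp add: v_def algebra_simps)
      then have "x \<in> U" using ua U submod_add by blast
      then show "x \<in> N" using U(3) ua by blast
    qed
    then have "?X \<inter> Y = N"
      using Int_greatest[OF subset_trans[OF U(2) UX] NY] by (rule equalityI)
    then have "?X = U" by (rule max[OF X subset_trans[OF U(2) UX] _ UX])
    moreover have "v = 0 + 1 * v" "1 \<in> A" using A by (auto simp: is_subring_def)
    then have "v \<in> ?X" using submod_0[OF U(1)] by blast
    ultimately have "v \<in> U" by simp
    then show False using vW UW by blast
  qed
  show ?thesis
  proof (rule that[OF U])
    show "\<exists>u\<in>U. \<exists>y\<in>Y. s = u + y" for s using sW[of s] by blast
  qed
qed

text \<open>\<open>p\<close> picks a \<open>Y\<close>-component along a complement \<open>U\<close>.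
  Since \<open>U\<close> and \<open>Y\<close> share \<open>N\<close>, the component is unique only
  up to \<open>N\<close>, so every property of \<open>p\<close> is a congruence.\<close>

lemma submod_projection:
  assumes A: "is_subring A" and N: "submod UNIV N" and reg: "regular_mod A N"
    and Y: "submod A Y" and NY: "N \<subseteq> Y"
  obtains p where "\<And>s. p s \<in> Y" "\<And>y. y \<in> Y \<Longrightarrow> cong_mod N (p y) y"
    "\<And>s t. cong_mod N (p (s + t)) (p s + p t)" "\<And>a s. a \<in> A \<Longrightarrow> cong_mod N (p (a * s)) (a * p s)"
    "\<And>n. n \<in> N \<Longrightarrow> p n \<in> N"
proof -
  obtain U where U: "submod A U" "N \<subseteq> U" "U \<inter> Y = N" "\<And>s. \<exists>u\<in>U. \<exists>y\<in>Y. s = u + y"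
    by (rule submod_complement[OF assms]) blast
  have "\<forall>s. \<exists>y. y \<in> Y \<and> s - y \<in> U" using U(4) by (metis add_diff_cancel_right')
  then obtain p where p: "\<And>s. p s \<in> Y" "\<And>s. s - p s \<in> U" by metis
  \<comment> \<open>Uniqueness of the component: additivity, linearity and the behaviour on
    \<open>Y\<close> and \<open>N\<close> all follow by exhibiting one admissible
    \<open>y\<close>.\<close>
  have *: "cong_mod N (p s) y" if "y \<in> Y" "s - y \<in> U" for s y
  proof -
    have "p s - y \<in> Y" using submod_diff[OF A Y] p that by blast
    moreover have "p s - y = (s - y) - (s - p s)" by simp
    then have "p s - y \<in> U" using submod_diff[OF A U(1)] p that by metis
    ultimately show ?thesis using U(3) unfolding cong_mod_def by blast
  qed
  show ?thesis
  proof (rule that[of p])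
    show "p s \<in> Y" for s by (rule p)
    show "cong_mod N (p y) y" if "y \<in> Y" for y
      using *[OF that] submod_0[OF U(1)] by simp
    show "cong_mod N (p (s + t)) (p s + p t)" for s t
    proof (rule *)
      show "p s + p t \<in> Y" using p Y submod_add by blast
      have "s + t - (p s + p t) = (s - p s) + (t - p t)" by simp
      then show "s + t - (p s + p t) \<in> U" using p submod_add[OF U(1)] by metis
    qed
    show "cong_mod N (p (a * s)) (a * p s)" if "a \<in> A" for a s
    proof (rule *)
      show "a * p s \<in> Y" using p Y submod_mult that by blast
      have "a * s - a * p s = a * (s - p s)" by (simp add: algebra_simps)
      then show "a * s - a * p s \<in> U" using p submod_mult[OF U(1) that] by metis
    qed
    show "p n \<in> N" if "n \<in> N" for n
    proof -
      have "cong_mod N (p n) n" using *[of n n] that NY submod_0[OF U(1)] by auto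
      then show ?thesis using that submod_add[OF N, of "p n - n" n] by (simp add: cong_mod_def)
    qed
  qed
qed

text \<open>The chain condition on powers of one element, with reducedness, makes
  \<open>A/(A \<inter> N)\<close> von Neumann regular (\<open>vn\<close>). If an ideal
  \<open>I\<close> had no idempotent generator, its idempotents could be enlarged forever, and their
  annihilators in \<open>I\<close> would descend strictly.\<close>

lemma dcc_reduced_regular_mod:
  assumes A: "is_subring A" and N: "submod UNIV N"
    and dcc: "\<And>I :: nat \<Rightarrow> 'a::comm_ring_1 set. (\<And>n. submod A (I n) \<and> N \<inter> A \<subseteq> I n \<and> I n \<subseteq> A \<and> I (Suc n) \<subseteq> I n)
      \<Longrightarrow> \<exists>m. \<forall>n\<ge>m. I n = I m"
    and red: "\<And>x n. x \<in> A \<Longrightarrow> x ^ n \<in> N \<Longrightarrow> x \<in> N"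
  shows "regular_mod A N"
proof -
  have NA: "submod A (N \<inter> A)"
    using submod_Int[OF submod_subset[OF N subset_UNIV] subring_submod[OF A]] .
  have vn: "\<exists>y\<in>A. x - x * (x * y) \<in> N" if x: "x \<in> A" for x
  proof -
    let ?I = "\<lambda>n. {v + w |v w. v \<in> {a * x ^ n |a. a \<in> A} \<and> w \<in> N \<inter> A}"
    have "\<exists>m. \<forall>n\<ge>m. ?I n = ?I m"
    proof (rule dcc, intro conjI)
      fix n
      show "submod A (?I n)" by (intro submod_plus submod_multiples NA A)
      show "N \<inter> A \<subseteq> ?I n"
        using submod_0[OF submod_multiples[OF A, of "x ^ n"]] by force
      show "?I n \<subseteq> A" using A subring_power[OF A x, of n] by (auto simp: is_subring_def)
      show "?I (Suc n) \<subseteq> ?I n"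
      proof
        fix z assume "z \<in> ?I (Suc n)"
        then obtain a w where "a \<in> A" "w \<in> N \<inter> A" "z = (a * x) * x ^ n + w"
          by (auto simp: mult.assoc)
        moreover then have "a * x \<in> A" using A x by (auto simp: is_subring_def)
        ultimately show "z \<in> ?I n" by blast
      qed
    qed
    then obtain m where "\<forall>n\<ge>m. ?I n = ?I m" ..
    then have m: "?I (Suc m) = ?I m" by (rule allE) (erule mp, simp)
    have "x ^ m = 1 * x ^ m + 0" "1 \<in> A" using A by (auto simp: is_subring_def)
    then have "x ^ m \<in> ?I m" using submod_0[OF NA] by blast
    then have "x ^ m \<in> ?I (Suc m)" by (simp only: m)
    then obtain y w where y: "y \<in> A" "w \<in> N" "x ^ m = y * x ^ Suc m + w" by blast
    \<comment> \<open>Stability of the chain gives \<open>x ^ m = y * x ^ Suc m + w\<close> with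
      \<open>w\<close> in \<open>N\<close>. One factor \<open>1 - x * y\<close> turns
      \<open>x ^ m\<close> into \<open>w\<close>, so \<open>x - x * (x * y)\<close> is nilpotent
      modulo \<open>N\<close>.\<close>
    have "(x - x * (x * y)) ^ Suc m = x * (1 - x * y) ^ Suc m * x ^ m"
    proof -
      have "x - x * (x * y) = x * (1 - x * y)" by (simp add: algebra_simps)
      then show ?thesis by (simp add: power_mult_distrib mult.commute mult.left_commute)
    qed
    also have "\<dots> = x * (1 - x * y) ^ m * (x ^ m - y * x ^ Suc m)"
      by (simp add: algebra_simps)
    also have "x ^ m - y * x ^ Suc m = w" using y(3) by (metis add_diff_cancel_left')
    finally have "(x - x * (x * y)) ^ Suc m \<in> N" using y ideal_mult[OF N] by simp
    moreover have "x - x * (x * y) \<in> A" using A x y by (auto simp: is_subring_def)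
    ultimately show ?thesis using red y by blast
  qed
  show ?thesis
    unfolding regular_mod_def
  proof (intro allI impI)
    fix I assume I: "submod A I" "I \<subseteq> A" "N \<inter> A \<subseteq> I"
    let ?R = "\<lambda>e. {x \<in> I. e * x \<in> N}"
    have Rsub: "submod A (?R e)" for e
      unfolding submod_def using I(1) N submod_0[OF N]
      by (auto simp: submod_def distrib_left mult.left_commute[of e])
    show "\<exists>e\<in>I. \<forall>x\<in>I. x - e * x \<in> N"
    proof (rule ccontr)
      assume neg: "\<not> (\<exists>e\<in>I. \<forall>x\<in>I. x - e * x \<in> N)"
      \<comment> \<open>The elements of \<open>I\<close> that are idempotent modulo
        \<open>N\<close>; \<open>?R e\<close> is the annihilator of \<open>e\<close> in
        \<open>I\<close>, modulo \<open>N\<close>.\<close>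
      let ?E = "{e \<in> I. e - e * e \<in> N}"
      have step: "\<exists>f\<in>?E. ?R f \<subset> ?R e" if e: "e \<in> ?E" for e
      proof -
        obtain x where x: "x \<in> I" "x - e * x \<notin> N" using neg e by blast
        \<comment> \<open>\<open>z\<close> witnesses that \<open>e\<close> does not generate
          \<open>I\<close>: it is killed by \<open>e\<close> modulo \<open>N\<close> but is not in
          \<open>N\<close>. Regularity turns it into an idempotent \<open>g = z * y\<close>
          orthogonal to \<open>e\<close> with \<open>g * z\<close> congruent to \<open>z\<close>, so
          \<open>z\<close> leaves the annihilator on passing to \<open>f = e + g\<close>.\<close>
        define z where "z = x - e * x"
        have zI: "z \<in> I" unfolding z_def
          using e I x by (auto intro!: submod_diff[OF A I(1)] submod_mult[OF I(1)])
        then obtain y where y: "y \<in> A" "z - z * (z * y) \<in> N" using vn I by blast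
        define g where "g = z * y"
        have gI: "g \<in> I" unfolding g_def using submod_mult[OF I(1) y(1) zI] by (simp add: mult.commute)
        have ez: "e * z \<in> N"
          using e ideal_mult_right[OF N, of "e - e * e" x] by (simp add: z_def algebra_simps)
        have eg: "e * g \<in> N" unfolding g_def using ideal_mult_right[OF N ez, of y] by (simp add: mult.assoc)
        have gg: "g - g * g \<in> N"
          using ideal_mult_right[OF N y(2), of y] by (simp add: g_def algebra_simps)
        define f where "f = e + g"
        have fI: "f \<in> I" using e gI submod_add[OF I(1)] by (simp add: f_def)
        have "f - f * f = (e - e * e) + (g - g * g) - 2 * (e * g)"
          by (simp add: f_def algebra_simps)
        then have ff: "f - f * f \<in> N"
          using e gg eg N by (simp add: ideal_diff submod_add ideal_mult)
        have "?R f \<subseteq> ?R e"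
        proof
          fix w assume w: "w \<in> ?R f"
          then have "e * (f * w) - e * g * w \<in> N"
            using eg N by (auto intro!: ideal_diff ideal_mult ideal_mult_right[OF N eg])
          then have 1: "e * e * w \<in> N" by (simp add: f_def algebra_simps)
          have "(e - e * e) * w \<in> N" using e ideal_mult_right[OF N] by simp
          from submod_add[OF N 1 this]
          show "w \<in> ?R e" using w by (simp add: algebra_simps)
        qed
        moreover have "z \<in> ?R e" using zI ez by simp
        moreover have "z \<notin> ?R f"
        proof
          assume "z \<in> ?R f"
          then have "f * z - e * z + (z - z * (z * y)) \<in> N"
            using ez y N by (simp add: ideal_diff submod_add)
          then have "z \<in> N" by (simp add: f_def g_def algebra_simps)
          then show False using x by (simp add: z_def)
        qed
        ultimately show ?thesis using fI ff by blast
      qed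
      have "\<exists>E. \<forall>n. E n \<in> ?E \<and> ?R (E (Suc n)) \<subset> ?R (E n)"
      proof (rule dependent_nat_choice)
        show "\<exists>e. e \<in> ?E" using submod_0[OF I(1)] submod_0[OF N] by force
        show "\<exists>f. f \<in> ?E \<and> ?R f \<subset> ?R e" if "e \<in> ?E" for e and n :: nat
          using step[OF that] by (simp only: Bex_def)
      qed
      then obtain E where "\<forall>n. E n \<in> ?E \<and> ?R (E (Suc n)) \<subset> ?R (E n)" ..
      then have E: "?R (E (Suc n)) \<subset> ?R (E n)" for n by (rule allE) (erule conjunct2)
      have "\<exists>m. \<forall>n\<ge>m. ?R (E n) = ?R (E m)"
      proof (rule dcc, intro conjI)
        fix n
        show "submod A (?R (E n))" by (rule Rsub)
        show "N \<inter> A \<subseteq> ?R (E n)" using I(3) ideal_mult[OF N] by blast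
        show "?R (E n) \<subseteq> A" using I(2) by blast
        show "?R (E (Suc n)) \<subseteq> ?R (E n)" by (rule psubset_imp_subset[OF E])
      qed
      then obtain m where "\<forall>n\<ge>m. ?R (E n) = ?R (E m)" ..
      then have "?R (E (Suc m)) = ?R (E m)" by (rule allE) (erule mp, simp)
      then show False using E[of m] by (simp only: psubset_eq) blast
    qed
  qed
qed

section \<open>The tensor square\<close>

text \<open>The free left \<open>S\<close>-module on the symbols \<open>[s]\<close> is a ring, namely the monoid algebra of the
  multiplicative monoid of \<open>S\<close>; the type below turns that monoid into an additive one, as the
  product of \<open>poly_mapping\<close> requires. The symbol \<open>a [s]\<close> stands for \<open>a \<otimes> s\<close>, and the quotient by
  \<open>tens_rel R C\<close> is \<open>S/C \<otimes>\<^sub>R S/C\<close> (for \<open>C \<subseteq> R\<close>).\<close>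

datatype 'a mul = Mul (unMul: 'a)

instantiation mul :: (comm_monoid_mult) comm_monoid_add
begin
definition "0 = Mul 1"
definition "x + y = Mul (unMul x * unMul y)"
instance by standard (auto simp: zero_mul_def plus_mul_def ac_simps)
end

type_synonym 'a tens = "'a mul \<Rightarrow>\<^sub>0 'a"

definition lft :: "'a::comm_ring_1 \<Rightarrow> 'a tens" where
  "lft a = Poly_Mapping.single 0 a"

definition rgt :: "'a::comm_ring_1 \<Rightarrow> 'a tens" where
  "rgt s = Poly_Mapping.single (Mul s) 1"

definition diag :: "'a::comm_ring_1 \<Rightarrow> 'a tens" where
  "diag s = lft s - rgt s"

text \<open>Additivity on the left is built into the free left module, and products of pure tensors
  into the monoid algebra. Imposed are additivity on the right, the transfer of scalars of
  \<open>R\<close>, and the vanishing of \<open>C\<close>.\<close>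

definition tens_rel :: "'a::comm_ring_1 set \<Rightarrow> 'a set \<Rightarrow> 'a tens set" where
  "tens_rel R C = mspan UNIV
    ({rgt (s + t) - rgt s - rgt t |s t. True} \<union> {diag r |r. r \<in> R} \<union> lft ` C)"

lemma lft_0: "lft 0 = 0" and lft_1: "lft 1 = 1"
  and lft_add: "lft (a + b) = lft a + lft b" and lft_mult: "lft (a * b) = lft a * lft b"
  by (simp_all add: lft_def single_add mult_single)

lemma lft_diff: "lft (a - b) = lft a - lft b"
  using lft_add[of "a - b" b] by (simp add: algebra_simps)

lemma lft_power: "lft (a ^ n) = lft a ^ n"
  by (induction n) (simp_all add: lft_1 lft_mult)

lemma rgt_1: "rgt 1 = 1" and rgt_mult: "rgt (a * b) = rgt a * rgt b"
  by (simp_all add: rgt_def mult_single plus_mul_def flip: zero_mul_def)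

lemma single_eq_lft_rgt: "Poly_Mapping.single k a = lft a * rgt (unMul k)"
  by (simp add: lft_def rgt_def mult_single plus_mul_def zero_mul_def)

lemma tens_eq_sum: "(\<Sum>k\<in>Poly_Mapping.keys p. Poly_Mapping.single k (Poly_Mapping.lookup p k)) = p"
proof (rule poly_mapping_eqI)
  fix j
  have "Poly_Mapping.lookup (\<Sum>k\<in>Poly_Mapping.keys p. Poly_Mapping.single k (Poly_Mapping.lookup p k)) j
      = (\<Sum>k\<in>Poly_Mapping.keys p. if k = j then Poly_Mapping.lookup p k else 0)"
    by (simp add: lookup_sum lookup_single when_def)
  also have "\<dots> = Poly_Mapping.lookup p j" by (simp add: in_keys_iff)
  finally show "Poly_Mapping.lookup (\<Sum>k\<in>Poly_Mapping.keys p. Poly_Mapping.single k (Poly_Mapping.lookup p k)) j = Poly_Mapping.lookup p j" .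
qed

lemma tens_induct [case_names monomial add]:
  fixes p :: "'a::comm_ring_1 tens"
  assumes "\<And>a s. P (lft a * rgt s)" "\<And>p q. P p \<Longrightarrow> P q \<Longrightarrow> P (p + q)"
  shows "P p"
proof -
  have 0: "P 0" using assms(1)[of 0] by (simp add: lft_0)
  have "P (\<Sum>k\<in>K. Poly_Mapping.single k (Poly_Mapping.lookup p k))" for K
    by (induction K rule: infinite_finite_induct)
      (auto simp: 0 assms(2) single_eq_lft_rgt assms(1))
  from this[of "Poly_Mapping.keys p"] show ?thesis by (simp add: tens_eq_sum)
qed

lemma ideal_tens_rel: "submod UNIV (tens_rel R C)"
  unfolding tens_rel_def by (rule submod_mspan)

lemma tens_rel_mono: "R \<subseteq> T \<Longrightarrow> tens_rel R C \<subseteq> tens_rel T C"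
  unfolding tens_rel_def by (rule mspan_mono) blast

lemma rgt_add: "cong_mod (tens_rel R C) (rgt (s + t)) (rgt s + rgt t)"
  unfolding cong_mod_def diff_diff_eq[symmetric] tens_rel_def by (rule mspan_base) blast

lemma diag_tens_rel: "r \<in> R \<Longrightarrow> diag r \<in> tens_rel R C"
  unfolding tens_rel_def by (rule mspan_base) blast

lemma lft_tens_rel: "c \<in> C \<Longrightarrow> lft c \<in> tens_rel R C"
  unfolding tens_rel_def by (rule mspan_base) blast

lemma rgt_tens_rel:
  assumes "c \<in> C" "C \<subseteq> R"
  shows "rgt c \<in> tens_rel R C"
proof -
  have "lft c - diag c \<in> tens_rel R C"
    using assms by (intro ideal_diff[OF ideal_tens_rel] lft_tens_rel diag_tens_rel) auto
  then show ?thesis by (simp add: diag_def)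
qed

section \<open>Maps out of the tensor square induced by balanced maps\<close>

definition balanced :: "'a::comm_ring_1 set \<Rightarrow> 'a set \<Rightarrow> 'b::comm_ring_1 set \<Rightarrow> ('a \<Rightarrow> 'a \<Rightarrow> 'b) \<Rightarrow> bool" where
  "balanced R C M \<beta> \<longleftrightarrow>
    (\<forall>x x' y. cong_mod M (\<beta> (x + x') y) (\<beta> x y + \<beta> x' y)) \<and>
    (\<forall>x y y'. cong_mod M (\<beta> x (y + y')) (\<beta> x y + \<beta> x y')) \<and>
    (\<forall>r\<in>R. \<forall>x y. cong_mod M (\<beta> (r * x) y) (\<beta> x (r * y))) \<and>
    (\<forall>c\<in>C. \<forall>y. \<beta> c y \<in> M)"

text \<open>The additive map induced by \<open>a \<otimes> s \<mapsto> \<beta> a s\<close>, computed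
  on representatives; it respects sums only modulo the target ideal \<open>M\<close>.\<close>

definition ev :: "('a::comm_ring_1 \<Rightarrow> 'a \<Rightarrow> 'b::comm_ring_1) \<Rightarrow> 'a tens \<Rightarrow> 'b" where
  "ev \<beta> p = (\<Sum>k\<in>Poly_Mapping.keys p. \<beta> (Poly_Mapping.lookup p k) (unMul k))"

context
  fixes R C :: "'a::comm_ring_1 set" and M :: "'b::comm_ring_1 set" and \<beta> :: "'a \<Rightarrow> 'a \<Rightarrow> 'b"
  assumes M: "submod UNIV M" and C: "submod UNIV C" and bal: "balanced R C M \<beta>"
begin

lemma balanced_0: "\<beta> 0 y \<in> M"
  using bal submod_0[OF C] unfolding balanced_def by blast

text \<open>Symbols outside the support contribute values \<open>\<beta> 0 y\<close>, which lie in
  \<open>M\<close>. This lets sums with different supports be compared over a common index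
  set.\<close>

lemma ev_superset:
  assumes "finite K" "Poly_Mapping.keys p \<subseteq> K"
  shows "cong_mod M (\<Sum>k\<in>K. \<beta> (Poly_Mapping.lookup p k) (unMul k)) (ev \<beta> p)"
proof -
  have "(\<Sum>k\<in>K. \<beta> (Poly_Mapping.lookup p k) (unMul k)) - ev \<beta> p = (\<Sum>k\<in>K - Poly_Mapping.keys p. \<beta> (Poly_Mapping.lookup p k) (unMul k))"
    unfolding ev_def by (subst sum.subset_diff[OF assms(2,1)]) simp
  also have "\<dots> \<in> M"
    by (rule submod_sum[OF M]) (simp add: in_keys_iff balanced_0)
  finally show ?thesis by (simp add: cong_mod_def)
qed

lemma ev_add: "cong_mod M (ev \<beta> (p + q)) (ev \<beta> p + ev \<beta> q)"
proof -
  let ?K = "Poly_Mapping.keys p \<union> Poly_Mapping.keys q"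
  let ?s = "\<lambda>p. \<Sum>k\<in>?K. \<beta> (Poly_Mapping.lookup p k) (unMul k)"
  have *: "cong_mod M (?s r) (ev \<beta> r)" if "Poly_Mapping.keys r \<subseteq> ?K" for r
    by (rule ev_superset[OF _ that]) simp
  have "cong_mod M (ev \<beta> (p + q)) (?s (p + q))"
    by (rule cong_mod_sym[OF M *]) (rule keys_add)
  moreover have "cong_mod M (?s (p + q)) (?s p + ?s q)"
    unfolding sum.distrib[symmetric]
    by (rule cong_mod_sum[OF M]) (use bal in \<open>simp add: lookup_add balanced_def\<close>)
  moreover have "cong_mod M (?s p + ?s q) (ev \<beta> p + ev \<beta> q)"
    by (intro cong_mod_add[OF M] *) auto
  ultimately show ?thesis using cong_mod_trans[OF M] by blast
qed

lemma ev_diff: "cong_mod M (ev \<beta> (p - q)) (ev \<beta> p - ev \<beta> q)"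
  using cong_mod_sym[OF M ev_add[of "p - q" q]] cong_mod_sym[OF M]
  by (simp add: cong_mod_def algebra_simps)

lemma ev_single: "cong_mod M (ev \<beta> (Poly_Mapping.single k a)) (\<beta> a (unMul k))"
proof -
  have "cong_mod M (\<Sum>k'\<in>{k}. \<beta> (Poly_Mapping.lookup (Poly_Mapping.single k a) k') (unMul k')) (ev \<beta> (Poly_Mapping.single k a))"
    by (rule ev_superset) (auto split: if_splits)
  then show ?thesis using cong_mod_sym[OF M] by simp
qed

lemma ev_sum: "finite K \<Longrightarrow> cong_mod M (ev \<beta> (\<Sum>k\<in>K. f k)) (\<Sum>k\<in>K. ev \<beta> (f k))"
proof (induction K rule: finite_induct)
  case empty
  then show ?case by (simp add: ev_def cong_mod_refl[OF M])
next
  case (insert k K)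
  then show ?case
    using cong_mod_trans[OF M ev_add cong_mod_add[OF M cong_mod_refl[OF M]]] by simp
qed

lemma ev_sum_single:
  assumes "finite K"
  shows "cong_mod M (ev \<beta> (\<Sum>k\<in>K. Poly_Mapping.single (g k) (f k))) (\<Sum>k\<in>K. \<beta> (f k) (unMul (g k)))"
  by (rule cong_mod_trans[OF M ev_sum[OF assms]]) (rule cong_mod_sum[OF M ev_single])

text \<open>The universal property of the tensor product: a balanced map factors through the
  quotient by \<open>tens_rel R C\<close>.\<close>

lemma ev_tens_rel:
  assumes "p \<in> tens_rel R C"
  shows "ev \<beta> p \<in> M"
proof -
  \<comment> \<open>Quantifying over all multipliers \<open>a\<close> makes \<open>?V\<close> an
    ideal; by \<open>gen\<close>, a generator of the relations then only has to be tested against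
    multiplication by pure tensors.\<close>
  let ?V = "{p. \<forall>a. ev \<beta> (a * p) \<in> M}"
  have memI: "x \<in> M" if "cong_mod M x y" "y \<in> M" for x y
    by (rule cong_mod_mem[OF M M subset_refl that])
  have "submod UNIV ?V"
    unfolding submod_def
  proof (intro conjI ballI)
    show "0 \<in> ?V" by (simp add: ev_def submod_0[OF M])
    show "p + q \<in> ?V" if "p \<in> ?V" "q \<in> ?V" for p q
      using that by (auto simp: distrib_left intro!: memI[OF ev_add] submod_add[OF M])
    show "b * p \<in> ?V" if "p \<in> ?V" for b p
      using that by (simp add: mult.assoc[symmetric])
  qed
  moreover have gen: "g \<in> ?V" if g: "\<And>x y. ev \<beta> (lft x * rgt y * g) \<in> M" for g
  proof -
    have "ev \<beta> (a * g) \<in> M" for a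
      by (induction a rule: tens_induct)
        (auto simp: distrib_right intro!: memI[OF ev_add] submod_add[OF M] g)
    then show ?thesis by blast
  qed
  have mono: "lft x * rgt y = Poly_Mapping.single (Mul y) x" for x y :: 'a
    by (simp add: single_eq_lft_rgt)
  have ev_mono: "cong_mod M (ev \<beta> (lft x * rgt y)) (\<beta> x y)" for x y
    using ev_single[of "Mul y" x] by (simp add: mono)
  have "rgt (s + t) - rgt s - rgt t \<in> ?V" for s t
  proof (rule gen)
    fix x y
    let ?e = "\<lambda>z. ev \<beta> (lft x * rgt (y * z))"
    have "cong_mod M (?e (s + t)) (\<beta> x (y * s + y * t))"
      using ev_mono by (simp add: distrib_left)
    moreover have "cong_mod M (\<beta> x (y * s + y * t)) (\<beta> x (y * s) + \<beta> x (y * t))"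
      using bal by (simp add: balanced_def)
    moreover have "cong_mod M (\<beta> x (y * s) + \<beta> x (y * t)) (?e s + ?e t)"
      by (intro cong_mod_add[OF M] cong_mod_sym[OF M ev_mono])
    moreover have "cong_mod M (?e s + ?e t) (ev \<beta> (lft x * rgt (y * s) + lft x * rgt (y * t)))"
      by (rule cong_mod_sym[OF M ev_add])
    ultimately have "cong_mod M (?e (s + t)) (ev \<beta> (lft x * rgt (y * s) + lft x * rgt (y * t)))"
      using cong_mod_trans[OF M] by blast
    then have "ev \<beta> (lft x * rgt (y * (s + t)) - (lft x * rgt (y * s) + lft x * rgt (y * t))) \<in> M"
      by (intro memI[OF ev_diff]) (simp add: cong_mod_def)
    then show "ev \<beta> (lft x * rgt y * (rgt (s + t) - rgt s - rgt t)) \<in> M"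
      unfolding rgt_mult by (simp add: algebra_simps)
  qed
  moreover have "diag r \<in> ?V" if "r \<in> R" for r
  proof (rule gen)
    fix x y
    have "cong_mod M (\<beta> (r * x) y) (\<beta> x (r * y))" using bal that by (simp add: balanced_def)
    then have "cong_mod M (ev \<beta> (lft (r * x) * rgt y)) (ev \<beta> (lft x * rgt (r * y)))"
      using ev_mono cong_mod_trans[OF M] cong_mod_sym[OF M] by meson
    then have "ev \<beta> (lft (r * x) * rgt y - lft x * rgt (r * y)) \<in> M"
      by (intro memI[OF ev_diff]) (simp add: cong_mod_def)
    then show "ev \<beta> (lft x * rgt y * diag r) \<in> M"
      by (simp add: diag_def rgt_mult lft_mult algebra_simps)
  qed
  moreover have "lft c \<in> ?V" if "c \<in> C" for c
  proof (rule gen)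
    fix x y
    have "x * c \<in> C" using that by (rule ideal_mult[OF C])
    then have "\<beta> (x * c) y \<in> M" using bal by (simp add: balanced_def)
    then have "ev \<beta> (lft (x * c) * rgt y) \<in> M" by (rule memI[OF ev_mono])
    then show "ev \<beta> (lft x * rgt y * lft c) \<in> M" by (simp add: lft_mult ac_simps)
  qed
  ultimately have "tens_rel R C \<subseteq> ?V"
    unfolding tens_rel_def by (intro mspan_minimal) blast+
  then have "ev \<beta> (1 * p) \<in> M" using assms by blast
  then show ?thesis by simp
qed

text \<open>Evaluates \<open>lft s * \<epsilon>\<close> and \<open>rgt s * \<epsilon>\<close>, which
  agree modulo the relations. This is the device that moves \<open>s\<close> from the left factors
  of \<open>\<epsilon>\<close> to the right ones.\<close>

lemma balanced_separability:
  assumes "diag s * \<epsilon> \<in> tens_rel R C"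
  shows "cong_mod M (\<Sum>k\<in>Poly_Mapping.keys \<epsilon>. \<beta> (s * Poly_Mapping.lookup \<epsilon> k) (unMul k))
    (\<Sum>k\<in>Poly_Mapping.keys \<epsilon>. \<beta> (Poly_Mapping.lookup \<epsilon> k) (s * unMul k))"
proof -
  have e: "\<epsilon> = (\<Sum>k\<in>Poly_Mapping.keys \<epsilon>. lft (Poly_Mapping.lookup \<epsilon> k) * rgt (unMul k))"
    using tens_eq_sum[of \<epsilon>] by (simp add: single_eq_lft_rgt)
  have "lft s * \<epsilon> = (\<Sum>k\<in>Poly_Mapping.keys \<epsilon>. Poly_Mapping.single k (s * Poly_Mapping.lookup \<epsilon> k))"
    by (subst e) (simp add: sum_distrib_left single_eq_lft_rgt lft_mult mult.assoc)
  then have 1: "cong_mod M (ev \<beta> (lft s * \<epsilon>)) (\<Sum>k\<in>Poly_Mapping.keys \<epsilon>. \<beta> (s * Poly_Mapping.lookup \<epsilon> k) (unMul k))"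
    using ev_sum_single[of "Poly_Mapping.keys \<epsilon>" "\<lambda>k. k"] by simp
  have "rgt s * \<epsilon> = (\<Sum>k\<in>Poly_Mapping.keys \<epsilon>. Poly_Mapping.single (Mul (s * unMul k)) (Poly_Mapping.lookup \<epsilon> k))"
    by (subst e) (simp add: sum_distrib_left single_eq_lft_rgt rgt_mult ac_simps)
  then have 2: "cong_mod M (ev \<beta> (rgt s * \<epsilon>)) (\<Sum>k\<in>Poly_Mapping.keys \<epsilon>. \<beta> (Poly_Mapping.lookup \<epsilon> k) (s * unMul k))"
    using ev_sum_single[of "Poly_Mapping.keys \<epsilon>" "\<lambda>k. Mul (s * unMul k)" "Poly_Mapping.lookup \<epsilon>"] by simp
  have "ev \<beta> (lft s * \<epsilon> - rgt s * \<epsilon>) \<in> M"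
    using ev_tens_rel[OF assms] by (simp add: diag_def left_diff_distrib)
  then have "cong_mod M (ev \<beta> (lft s * \<epsilon>)) (ev \<beta> (rgt s * \<epsilon>))"
    unfolding cong_mod_def
    by (rule cong_mod_mem[OF M M subset_refl cong_mod_sym[OF M ev_diff]])
  then show ?thesis
    using 1 2 cong_mod_trans[OF M] cong_mod_sym[OF M] by meson
qed

end

section \<open>The separability idempotent of an unramified extension\<close>

lemma diag_add: "cong_mod (tens_rel R C) (diag (s + t)) (diag s + diag t)"
proof -
  have "diag (s + t) - (diag s + diag t) = (rgt s + rgt t) - rgt (s + t)"
    by (simp add: diag_def lft_add)
  then show ?thesis
    using cong_mod_sym[OF ideal_tens_rel rgt_add, of R C s t] by (simp add: cong_mod_def)
qed

lemma diag_mult: "diag (s * t) = lft s * diag t + rgt t * diag s"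
  by (simp add: diag_def lft_mult rgt_mult algebra_simps)

text \<open>\<open>diag\<close> is additive modulo the relations and obeys a twisted Leibniz rule,
  so induction over the generated algebra applies. With \<open>F\<close> finite this makes the
  diagonal ideal finitely generated modulo the relations.\<close>

lemma diag_mspan_generators:
  fixes R :: "'a::comm_ring_1 set"
  assumes "is_subring R" "alg_gen R F = UNIV"
  shows "diag s \<in> mspan UNIV (diag ` F \<union> tens_rel R C)"
proof -
  let ?W = "mspan UNIV (diag ` F \<union> tens_rel R C)"
  have W: "submod UNIV ?W" by (rule submod_mspan)
  have QW: "tens_rel R C \<subseteq> ?W" using mspan_superset by blast
  note mem = cong_mod_mem[OF ideal_tens_rel W QW]
  have "s \<in> alg_gen R F \<Longrightarrow> diag s \<in> ?W" for s
  proof (induction rule: alg_gen.induct)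
    case (base r)
    then show ?case using QW diag_tens_rel by blast
  next
    case (gen x)
    then show ?case by (intro mspan_base) simp
  next
    case (add x y)
    then show ?case by (intro mem[OF diag_add] submod_add[OF W])
  next
    case (neg x)
    \<comment> \<open>Negation is treated as the product of \<open>- 1\<close> and \<open>x\<close>,
      where \<open>diag (- 1)\<close> is itself a relation because \<open>- 1\<close> lies in
      \<open>R\<close>.\<close>
    have "- 1 \<in> R" using assms(1) by (intro subring_uminus) (auto simp: is_subring_def)
    then have "diag (- 1) \<in> ?W" using QW diag_tens_rel by blast
    then have "lft (- 1) * diag x + rgt x * diag (- 1) \<in> ?W"
      using neg by (intro submod_add[OF W] ideal_mult[OF W])
    then show ?case by (simp flip: diag_mult)
  next
    case (mult x y)
    then show ?case unfolding diag_mult by (intro submod_add[OF W] ideal_mult[OF W])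
  qed
  then show ?thesis using assms(2) by blast
qed

text \<open>The map s \<mapsto> diag s is a derivation modulo the square of the diagonal ideal.\<close>

lemma kaehler_zero_diag_square:
  fixes R :: "'a::comm_ring_1 set"
  assumes "kaehler_zero R"
  shows "diag s \<in> mspan UNIV ({diag s * diag t |s t. True} \<union> tens_rel R C)"
proof -
  let ?W = "mspan UNIV ({diag s * diag t |s t. True} \<union> tens_rel R C)"
  \<comment> \<open>The linear extension of \<open>dsym x \<mapsto> diag x\<close>; it is shown to
    send every Kaehler relation into \<open>?W\<close>.\<close>
  let ?\<Phi> = "\<lambda>f :: 'a \<Rightarrow> 'a. \<Sum>x\<in>{x. f x \<noteq> 0}. lft (f x) * diag x"
  have W: "submod UNIV ?W" by (rule submod_mspan)
  have QW: "tens_rel R C \<subseteq> ?W" using mspan_superset by blast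
  have dd: "diag s * diag t \<in> ?W" for s t by (rule mspan_base) blast
  have sup: "?\<Phi> f = (\<Sum>x\<in>X. lft (f x) * diag x)" if "finite X" "{x. f x \<noteq> 0} \<subseteq> X" for f X
    by (rule sum.mono_neutral_left) (use that in \<open>auto simp: lft_0\<close>)
  have dsym: "(\<Sum>x\<in>X. lft (c * dsym s x) * diag x) = lft c * diag s" if "finite X" "s \<in> X" for X c s
  proof -
    have "(\<Sum>x\<in>X. lft (c * dsym s x) * diag x) = (\<Sum>x\<in>X. if x = s then lft c * diag s else 0)"
      by (rule sum.cong) (auto simp: dsym_def lft_0)
    then show ?thesis using that by simp
  qed
  have dsym1: "(\<Sum>x\<in>X. lft (dsym s x) * diag x) = diag s" if "finite X" "s \<in> X" for X s
    using dsym[OF that, of 1] by (simp add: lft_1)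
  \<comment> \<open>Finite support is proved along with membership, since comparing the sums
    requires a common finite index set.\<close>
  have *: "finite {x. f x \<noteq> 0} \<and> ?\<Phi> f \<in> ?W" if "f \<in> kaehler_rel R" for f
    using that
  proof (induction rule: kaehler_rel.induct)
    case zero
    then show ?case using submod_0[OF W] by simp
  next
    case (rel_add s t)
    let ?f = "\<lambda>x. dsym (s + t) x - dsym s x - dsym t x" and ?X = "{s + t, s, t}"
    have X: "{x. ?f x \<noteq> 0} \<subseteq> ?X" by (auto simp: dsym_def)
    have "?\<Phi> ?f = (\<Sum>x\<in>?X. lft (?f x) * diag x)" by (rule sup[OF _ X]) simp
    also have "\<dots> = diag (s + t) - diag s - diag t"
      by (simp add: lft_diff left_diff_distrib sum_subtractf dsym1 del: sum.insert sum.insert_if)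
    also have "\<dots> \<in> ?W"
      using diag_add[of R C s t] QW by (auto simp: cong_mod_def diff_diff_eq)
    finally show ?case using finite_subset[OF X] by simp
  next
    case (rel_mult s t)
    let ?f = "\<lambda>x. dsym (s * t) x - s * dsym t x - t * dsym s x" and ?X = "{s * t, s, t}"
    have X: "{x. ?f x \<noteq> 0} \<subseteq> ?X" by (auto simp: dsym_def)
    have "?\<Phi> ?f = (\<Sum>x\<in>?X. lft (?f x) * diag x)" by (rule sup[OF _ X]) simp
    also have "\<dots> = diag (s * t) - lft s * diag t - lft t * diag s"
      by (simp add: lft_diff left_diff_distrib sum_subtractf dsym dsym1 del: sum.insert sum.insert_if)
    \<comment> \<open>The failure of the Leibniz rule with left scalars only is exactly a product of
      two diagonal elements.\<close>
    also have "\<dots> = - (diag s * diag t)"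
      by (simp add: diag_def lft_mult rgt_mult algebra_simps)
    also have "\<dots> \<in> ?W" by (rule ideal_uminus[OF W dd])
    finally show ?case using finite_subset[OF X] by simp
  next
    case (rel_const r)
    have X: "{x. dsym r x \<noteq> 0} \<subseteq> {r}" by (auto simp: dsym_def)
    have "?\<Phi> (dsym r) = (\<Sum>x\<in>{r}. lft (dsym r x) * diag x)" by (rule sup[OF _ X]) simp
    also have "\<dots> = diag r" by (rule dsym1) auto
    also have "diag r \<in> ?W" using QW diag_tens_rel[OF rel_const] by blast
    finally show ?case using finite_subset[OF X] by simp
  next
    case (sum f g)
    let ?X = "{x. f x \<noteq> 0} \<union> {x. g x \<noteq> 0}"
    have fin: "finite ?X" using sum.IH by simp
    have X: "{x. f x + g x \<noteq> 0} \<subseteq> ?X" by auto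
    have "?\<Phi> (\<lambda>x. f x + g x) = (\<Sum>x\<in>?X. lft (f x) * diag x) + (\<Sum>x\<in>?X. lft (g x) * diag x)"
      unfolding sup[OF fin X] by (simp add: lft_add distrib_right sum.distrib)
    also have "\<dots> = ?\<Phi> f + ?\<Phi> g" using sup[OF fin, of f] sup[OF fin, of g] by simp
    finally show ?case using sum.IH finite_subset[OF X fin] submod_add[OF W] by simp
  next
    case (smult f c)
    let ?X = "{x. f x \<noteq> 0}"
    have fin: "finite ?X" using smult.IH by simp
    have X: "{x. c * f x \<noteq> 0} \<subseteq> ?X" by auto
    have "?\<Phi> (\<lambda>x. c * f x) = lft c * ?\<Phi> f"
      unfolding sup[OF fin X] by (simp add: lft_mult sum_distrib_left mult.assoc)
    then show ?case using smult.IH finite_subset[OF X fin] ideal_mult[OF W] by simp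
  qed
  have "dsym s \<in> kaehler_rel R" using assms by (simp add: kaehler_zero_def)
  then have "?\<Phi> (dsym s) \<in> ?W" by (rule *[THEN conjunct2])
  moreover have "?\<Phi> (dsym s) = (\<Sum>x\<in>{s}. lft (dsym s x) * diag x)"
    by (rule sup) (auto simp: dsym_def)
  moreover have "\<dots> = diag s" by (rule dsym1) auto
  ultimately show ?thesis by (simp only:)
qed

text \<open>Nakayama's lemma, eliminating one generator at a time.\<close>

lemma idempotent_ideal_annihilator:
  fixes Q :: "'a::comm_ring_1 set"
  assumes Q: "submod UNIV Q" and fin: "finite F"
    and gen: "D \<subseteq> mspan UNIV (F \<union> Q)" and FD: "F \<subseteq> D"
    and sq: "D \<subseteq> mspan UNIV ({x * y |x y. x \<in> D \<and> y \<in> D} \<union> Q)"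
  obtains j where "j \<in> mspan UNIV D" "\<And>x. x \<in> D \<Longrightarrow> (1 - j) * x \<in> Q"
proof -
  let ?J = "mspan UNIV D"
  have J: "submod UNIV ?J" by (rule submod_mspan)
  have DJ: "D \<subseteq> ?J" by (rule mspan_superset)
  \<comment> \<open>Generators are removed from \<open>G\<close> while \<open>j\<close> is adjusted
    inside \<open>?J\<close>; at the empty set only \<open>Q\<close> remains.\<close>
  have elim: "\<exists>j\<in>?J. \<forall>x\<in>D. (1 - j) * x \<in> Q"
    if "finite G" "G \<subseteq> D" "\<exists>j\<in>?J. \<forall>x\<in>D. (1 - j) * x \<in> mspan UNIV (G \<union> Q)" for G
    using that
  proof (induction G rule: finite_induct)
    case empty
    have "mspan UNIV ({} \<union> Q) \<subseteq> Q" by (rule mspan_minimal[OF Q]) simp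
    then show ?case using empty.prems by blast
  next
    case (insert g G)
    let ?M = "mspan UNIV (G \<union> Q)"
    have M: "submod UNIV ?M" by (rule submod_mspan)
    have QM: "Q \<subseteq> ?M" using mspan_superset by blast
    obtain j where j: "j \<in> ?J" "\<And>x. x \<in> D \<Longrightarrow> (1 - j) * x \<in> mspan UNIV (insert g (G \<union> Q))"
      using insert.prems by auto
    have ex: "\<exists>b m. m \<in> ?M \<and> (1 - j) * x = b * g + m" if "x \<in> D" for x
      using mspan_insert[OF is_subring_UNIV j(2)[OF that]] by metis
    \<comment> \<open>Those \<open>z\<close> for which \<open>(1 - j) * z\<close> is a multiple of
      \<open>g\<close> modulo \<open>?M\<close>, with coefficient in \<open>?J\<close>. Products of
      two elements of \<open>D\<close> qualify, so \<open>sq\<close> puts \<open>g\<close> itself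
      here.\<close>
    let ?V = "{z. \<exists>i\<in>?J. (1 - j) * z - i * g \<in> ?M}"
    have "submod UNIV ?V"
      unfolding submod_def
    proof (intro conjI ballI)
      show "0 \<in> ?V" using submod_0[OF J] submod_0[OF M] by force
    next
      fix x y assume "x \<in> ?V" "y \<in> ?V"
      then obtain i k where ik: "i \<in> ?J" "k \<in> ?J" "(1 - j) * x - i * g \<in> ?M" "(1 - j) * y - k * g \<in> ?M"
        by blast
      have "((1 - j) * x - i * g) + ((1 - j) * y - k * g) \<in> ?M" using ik submod_add[OF M] by blast
      then have "(1 - j) * (x + y) - (i + k) * g \<in> ?M" by (simp add: algebra_simps)
      then show "x + y \<in> ?V" using submod_add[OF J ik(1,2)] by blast
    next
      fix a x assume "x \<in> ?V"
      then obtain i where i: "i \<in> ?J" "(1 - j) * x - i * g \<in> ?M" by blast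
      have "a * ((1 - j) * x - i * g) \<in> ?M" using i ideal_mult[OF M] by blast
      then have "(1 - j) * (a * x) - (a * i) * g \<in> ?M" by (simp add: algebra_simps)
      then show "a * x \<in> ?V" using ideal_mult[OF J i(1)] by blast
    qed
    moreover have "x * y \<in> ?V" if xy: "x \<in> D" "y \<in> D" for x y
    proof -
      obtain b m where bm: "m \<in> ?M" "(1 - j) * x = b * g + m" using ex[OF xy(1)] by blast
      have "(1 - j) * (x * y) - (b * y) * g = y * m"
        using arg_cong[OF bm(2), of "\<lambda>z. y * z"] by (simp add: algebra_simps)
      also have "y * m \<in> ?M" using bm ideal_mult[OF M] by blast
      finally have "(1 - j) * (x * y) - (b * y) * g \<in> ?M" .
      moreover have "b * y \<in> ?J" using xy DJ ideal_mult[OF J] by blast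
      ultimately show ?thesis by blast
    qed
    moreover have "q \<in> ?V" if "q \<in> Q" for q
    proof -
      have "(1 - j) * q - 0 * g \<in> ?M" using that QM ideal_mult[OF M, of q "1 - j"] by auto
      then show ?thesis using submod_0[OF J] by blast
    qed
    ultimately have "mspan UNIV ({x * y |x y. x \<in> D \<and> y \<in> D} \<union> Q) \<subseteq> ?V"
      by (intro mspan_minimal) blast+
    then have "g \<in> ?V" using sq insert.prems(1) by blast
    then obtain i where i: "i \<in> ?J" "(1 - j) * g - i * g \<in> ?M" by blast
    \<comment> \<open>Chosen so that \<open>1 - k = (1 - j - i) * (1 - j)\<close>: the second factor
      reduces \<open>D\<close> to multiples of \<open>g\<close> modulo \<open>?M\<close>, and the
      first kills \<open>g\<close> modulo \<open>?M\<close>.\<close>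
    define k where "k = j + i + j - (j + i) * j"
    have "k \<in> ?J" unfolding k_def
      by (intro ideal_diff[OF J] submod_add[OF J] ideal_mult[OF J] i j)
    moreover have "(1 - k) * x \<in> ?M" if "x \<in> D" for x
    proof -
      obtain b m where bm: "m \<in> ?M" "(1 - j) * x = b * g + m" using ex[OF \<open>x \<in> D\<close>] by blast
      have "(1 - k) * x = (1 - j - i) * ((1 - j) * x)" by (simp add: k_def algebra_simps)
      also have "\<dots> = b * ((1 - j) * g - i * g) + (1 - j - i) * m"
        unfolding bm by (simp add: algebra_simps)
      also have "\<dots> \<in> ?M" by (intro submod_add[OF M] ideal_mult[OF M] i bm)
      finally show ?thesis .
    qed
    ultimately show ?case using insert.IH insert.prems(1) by blast
  qed
  have "\<exists>j\<in>?J. \<forall>x\<in>D. (1 - j) * x \<in> mspan UNIV (F \<union> Q)"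
    using submod_0[OF J] gen by force
  from elim[OF fin FD this] show ?thesis by (elim bexE) (rule that, auto)
qed

text \<open>Takes \<open>\<epsilon> = 1 - j\<close> for the \<open>j\<close> supplied by Nakayama.
  As \<open>j\<close> lies in the diagonal ideal, the multiplication map sends it into
  \<open>C\<close>, hence sends \<open>\<epsilon>\<close> to 1 modulo \<open>C\<close>.\<close>

lemma unramified_separability_element:
  fixes R :: "'a::comm_ring_1 set"
  assumes R: "is_subring R" and C: "submod UNIV C" and unr: "unramified R"
  obtains \<epsilon> where "\<And>s. diag s * \<epsilon> \<in> tens_rel R C"
    "(\<Sum>k\<in>Poly_Mapping.keys \<epsilon>. Poly_Mapping.lookup \<epsilon> k * unMul k) - 1 \<in> C"
proof -
  obtain F where F: "finite F" "alg_gen R F = UNIV"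
    using unr by (auto simp: unramified_def finite_type_def)
  have "\<exists>j\<in>mspan UNIV (range diag). \<forall>x\<in>range diag. (1 - j) * x \<in> tens_rel R C"
  proof (rule idempotent_ideal_annihilator[OF ideal_tens_rel])
    show "finite (diag ` F)" using F by simp
    show "range diag \<subseteq> mspan UNIV (diag ` F \<union> tens_rel R C)"
      using diag_mspan_generators[OF R F(2)] by blast
    have *: "{x * y |x y. x \<in> range diag \<and> y \<in> range diag} = {diag s * diag t |s t. True}" by blast
    show "range diag \<subseteq> mspan UNIV ({x * y |x y. x \<in> range diag \<and> y \<in> range diag} \<union> tens_rel R C)"
      unfolding * using kaehler_zero_diag_square[of R] unr unfolding unramified_def by blast
  qed blast+
  then obtain j where j: "j \<in> mspan UNIV (range diag)" "\<And>s. (1 - j) * diag s \<in> tens_rel R C"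
    by blast
  \<comment> \<open>Multiplication is balanced over all of \<open>S\<close>, so it sends
    \<open>tens_rel UNIV C\<close>, which contains every \<open>diag s\<close>, into
    \<open>C\<close>.\<close>
  have bal: "balanced UNIV C C (*)"
    using C by (simp add: balanced_def algebra_simps cong_mod_refl ideal_mult_right)
  have "mspan UNIV (range diag) \<subseteq> tens_rel UNIV C"
    by (rule mspan_minimal[OF ideal_tens_rel]) (auto intro: diag_tens_rel)
  then have "ev (*) j \<in> C" using ev_tens_rel[OF C C bal] j(1) by blast
  have "cong_mod C (ev (*) (1 - j)) (ev (*) 1 - ev (*) j)" by (rule ev_diff[OF C C bal])
  moreover have "ev (*) 1 = (1::'a)"
    by (simp add: ev_def zero_mul_def lookup_one)
  ultimately have "ev (*) (1 - j) - 1 + ev (*) j \<in> C"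
    by (simp add: cong_mod_def algebra_simps)
  from ideal_diff[OF C this \<open>ev (*) j \<in> C\<close>] have "ev (*) (1 - j) - 1 \<in> C" by simp
  then show ?thesis
    using that[of "1 - j"] j(2) by (simp add: ev_def mult.commute)
qed

section \<open>Averaging\<close>

definition additive_mod :: "'a::comm_ring_1 set \<Rightarrow> ('a \<Rightarrow> 'a) \<Rightarrow> bool" where
  "additive_mod N p \<longleftrightarrow> (\<forall>v w. cong_mod N (p (v + w)) (p v + p w)) \<and> (\<forall>n\<in>N. p n \<in> N)"

text \<open>A ring map on representatives. It is applied to \<open>lft\<close> and
  \<open>rgt\<close>, the two maps of \<open>S\<close> into the tensor square; \<open>rgt\<close> is
  additive only modulo the relations.\<close>

definition hom_mod :: "'a::comm_ring_1 set \<Rightarrow> 'b::comm_ring_1 set \<Rightarrow> ('a \<Rightarrow> 'b) \<Rightarrow> bool" where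
  "hom_mod C N h \<longleftrightarrow> (\<forall>x y. cong_mod N (h (x + y)) (h x + h y)) \<and>
    (\<forall>x y. cong_mod N (h (x * y)) (h x * h y)) \<and> cong_mod N (h 1) 1 \<and> (\<forall>c\<in>C. h c \<in> N)"

text \<open>Maschke averaging, with the separability element in the role of the normalized sum over
  a group.\<close>

definition avg :: "'a::comm_ring_1 tens \<Rightarrow> ('a \<Rightarrow> 'b::comm_ring_1) \<Rightarrow> ('b \<Rightarrow> 'b) \<Rightarrow> 'b \<Rightarrow> 'b" where
  "avg \<epsilon> h p v = (\<Sum>k\<in>Poly_Mapping.keys \<epsilon>. h (Poly_Mapping.lookup \<epsilon> k) * p (h (unMul k) * v))"

lemma additive_mod_cong:
  assumes N: "submod UNIV N" and p: "additive_mod N p" and vw: "cong_mod N v w"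
  shows "cong_mod N (p v) (p w)"
proof -
  have "cong_mod N (p ((v - w) + w)) (p (v - w) + p w)" using p by (simp only: additive_mod_def)
  then have "p v - (p (v - w) + p w) \<in> N" by (simp add: cong_mod_def)
  moreover have "p (v - w) \<in> N" using p vw by (simp add: additive_mod_def cong_mod_def)
  ultimately have "p v - (p (v - w) + p w) + p (v - w) \<in> N" by (rule submod_add[OF N])
  then show ?thesis by (simp add: cong_mod_def)
qed

lemma additive_mod_avg:
  assumes N: "submod UNIV N" and p: "additive_mod N p"
  shows "additive_mod N (avg \<epsilon> h p)"
  unfolding additive_mod_def
proof (intro conjI allI ballI)
  show "cong_mod N (avg \<epsilon> h p (v + w)) (avg \<epsilon> h p v + avg \<epsilon> h p w)" for v w
    unfolding avg_def sum.distrib[symmetric] distrib_left[symmetric]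
    by (intro cong_mod_sum[OF N] cong_mod_mult_left[OF N])
      (use p in \<open>simp add: distrib_left additive_mod_def\<close>)
  show "avg \<epsilon> h p n \<in> N" if "n \<in> N" for n
    unfolding avg_def
    by (intro submod_sum[OF N] ideal_mult[OF N])
      (use p ideal_mult[OF N that] in \<open>auto simp: additive_mod_def\<close>)
qed

lemma avg_mem: "submod UNIV H \<Longrightarrow> (\<And>v. p v \<in> H) \<Longrightarrow> avg \<epsilon> h p v \<in> H"
  unfolding avg_def by (intro submod_sum ideal_mult)

text \<open>Averaging through one tensor factor preserves linearity already obtained over the
  other.\<close>

lemma avg_commute:
  assumes N: "submod UNIV N" and g: "\<And>v. cong_mod N (p (g * v)) (g * p v)"
  shows "cong_mod N (avg \<epsilon> h p (g * v)) (g * avg \<epsilon> h p v)"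
  unfolding avg_def sum_distrib_left
proof (rule cong_mod_sum[OF N])
  fix k
  show "cong_mod N (h (Poly_Mapping.lookup \<epsilon> k) * p (h (unMul k) * (g * v)))
      (g * (h (Poly_Mapping.lookup \<epsilon> k) * p (h (unMul k) * v)))"
    using cong_mod_mult_left[OF N g[of "h (unMul k) * v"], of "h (Poly_Mapping.lookup \<epsilon> k)"]
    by (simp add: mult.left_commute)
qed

text \<open>For fixed \<open>v\<close>, the map \<open>?\<beta>\<close> is balanced because
  \<open>p\<close> is linear over \<open>R\<close>; the separability identity then carries
  \<open>h s\<close> out of the argument of \<open>p\<close>.\<close>

lemma avg_linear:
  assumes C: "submod UNIV C" and N: "submod UNIV N" and h: "hom_mod C N h" and p: "additive_mod N p"
    and pR: "\<And>r v. r \<in> R \<Longrightarrow> cong_mod N (p (h r * v)) (h r * p v)"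
    and sep: "diag s * \<epsilon> \<in> tens_rel R C"
  shows "cong_mod N (avg \<epsilon> h p (h s * v)) (h s * avg \<epsilon> h p v)"
proof -
  note tr = cong_mod_trans[OF N] and sy = cong_mod_sym[OF N] and rf = cong_mod_refl[OF N]
    and ml = cong_mod_mult_left[OF N] and mm = cong_mod_mult[OF N]
  have h_add: "cong_mod N (h (x + y)) (h x + h y)" and h_mult: "cong_mod N (h (x * y)) (h x * h y)" for x y
    using h by (auto simp: hom_mod_def)
  note pc = additive_mod_cong[OF N p]
  let ?\<beta> = "\<lambda>x y. h x * p (h y * v)"
  have ph_mult: "cong_mod N (p (h (x * y) * v)) (p (h x * (h y * v)))" for x y
    unfolding mult.assoc[symmetric] by (intro pc mm rf h_mult)
  have "balanced R C N ?\<beta>"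
    unfolding balanced_def
  proof (intro conjI allI ballI)
    show "cong_mod N (?\<beta> (x + x') y) (?\<beta> x y + ?\<beta> x' y)" for x x' y
      unfolding distrib_right[symmetric] by (intro mm rf h_add)
    show "cong_mod N (?\<beta> x (y + y')) (?\<beta> x y + ?\<beta> x y')" for x y y'
    proof -
      have "cong_mod N (p (h (y + y') * v)) (p ((h y + h y') * v))" by (intro pc mm rf h_add)
      moreover have "cong_mod N (p ((h y + h y') * v)) (p (h y * v) + p (h y' * v))"
        using p by (simp add: additive_mod_def distrib_right)
      ultimately show ?thesis unfolding distrib_left[symmetric] using ml tr by blast
    qed
    show "cong_mod N (?\<beta> (r * x) y) (?\<beta> x (r * y))" if "r \<in> R" for r x y
    proof -
      have "cong_mod N (p (h (r * y) * v)) (h r * p (h y * v))"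
        using tr[OF ph_mult pR[OF that]] .
      then have "cong_mod N (?\<beta> x (r * y)) (h x * (h r * p (h y * v)))" by (rule ml)
      moreover have "cong_mod N (?\<beta> (r * x) y) (h r * h x * p (h y * v))" by (intro mm rf h_mult)
      ultimately show ?thesis using tr sy by (metis mult.assoc mult.commute)
    qed
    show "?\<beta> c y \<in> N" if "c \<in> C" for c y
      using h that ideal_mult_right[OF N] by (simp add: hom_mod_def)
  qed
  from balanced_separability[OF N C this sep]
  have 1: "cong_mod N (\<Sum>k\<in>Poly_Mapping.keys \<epsilon>. ?\<beta> (s * Poly_Mapping.lookup \<epsilon> k) (unMul k))
    (\<Sum>k\<in>Poly_Mapping.keys \<epsilon>. ?\<beta> (Poly_Mapping.lookup \<epsilon> k) (s * unMul k))" .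
  have 2: "cong_mod N (\<Sum>k\<in>Poly_Mapping.keys \<epsilon>. ?\<beta> (s * Poly_Mapping.lookup \<epsilon> k) (unMul k)) (h s * avg \<epsilon> h p v)"
    unfolding avg_def sum_distrib_left mult.assoc[symmetric, of "h s"]
    by (intro cong_mod_sum[OF N] mm rf h_mult)
  have 3: "cong_mod N (\<Sum>k\<in>Poly_Mapping.keys \<epsilon>. ?\<beta> (Poly_Mapping.lookup \<epsilon> k) (s * unMul k)) (avg \<epsilon> h p (h s * v))"
    unfolding avg_def
    by (intro cong_mod_sum[OF N] ml) (use ph_mult[of _ s] in \<open>simp add: mult.commute[of s]\<close>)
  show ?thesis using sy[OF 3] sy[OF 1] 2 tr by blast
qed

text \<open>For \<open>v\<close> in the ideal \<open>H\<close>, each \<open>h (unMul k) * v\<close>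
  stays in \<open>H\<close>, where \<open>p\<close> acts as the identity modulo \<open>N\<close>.
  The average collapses to \<open>h\<close> of the unit sum, times \<open>v\<close>.\<close>

lemma avg_fix:
  assumes C: "submod UNIV C" and N: "submod UNIV N" and h: "hom_mod C N h"
    and H: "submod UNIV H" and pH: "\<And>v. v \<in> H \<Longrightarrow> cong_mod N (p v) v"
    and unit: "(\<Sum>k\<in>Poly_Mapping.keys \<epsilon>. Poly_Mapping.lookup \<epsilon> k * unMul k) - 1 \<in> C" and v: "v \<in> H"
  shows "cong_mod N (avg \<epsilon> h p v) v"
proof -
  note tr = cong_mod_trans[OF N] and sy = cong_mod_sym[OF N] and rf = cong_mod_refl[OF N]
    and ml = cong_mod_mult_left[OF N] and mm = cong_mod_mult[OF N]
  let ?x = "Poly_Mapping.lookup \<epsilon>"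
  have h_add: "cong_mod N (h (x + y)) (h x + h y)" and h_mult: "cong_mod N (h (x * y)) (h x * h y)" for x y
    using h by (auto simp: hom_mod_def)
  have h_sum: "finite K \<Longrightarrow> cong_mod N (\<Sum>k\<in>K. h (f k)) (h (\<Sum>k\<in>K. f k))" for K :: "'a mul set" and f
  proof (induction K rule: finite_induct)
    case empty
    have "h 0 \<in> N" using h submod_0[OF C] by (simp add: hom_mod_def)
    then show ?case using ideal_uminus[OF N] by (simp add: cong_mod_def)
  next
    case (insert k K)
    then show ?case using tr[OF cong_mod_add[OF N rf insert.IH] sy[OF h_add]] by simp
  qed
  have 1: "cong_mod N (avg \<epsilon> h p v) (\<Sum>k\<in>Poly_Mapping.keys \<epsilon>. h (?x k * unMul k) * v)"
    unfolding avg_def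
  proof (rule cong_mod_sum[OF N])
    fix k
    have "cong_mod N (h (?x k) * p (h (unMul k) * v)) (h (?x k) * (h (unMul k) * v))"
      by (intro ml pH ideal_mult[OF H v])
    moreover have "cong_mod N (h (?x k * unMul k) * v) (h (?x k) * h (unMul k) * v)"
      by (intro mm rf h_mult)
    ultimately show "cong_mod N (h (?x k) * p (h (unMul k) * v)) (h (?x k * unMul k) * v)"
      using tr sy by (metis mult.assoc)
  qed
  have 2: "cong_mod N (\<Sum>k\<in>Poly_Mapping.keys \<epsilon>. h (?x k * unMul k) * v)
      (h (\<Sum>k\<in>Poly_Mapping.keys \<epsilon>. ?x k * unMul k) * v)"
    unfolding sum_distrib_right[symmetric] by (intro mm rf h_sum) simp
  have "cong_mod N (h (\<Sum>k\<in>Poly_Mapping.keys \<epsilon>. ?x k * unMul k)) 1"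
  proof -
    define t where "t = (\<Sum>k\<in>Poly_Mapping.keys \<epsilon>. ?x k * unMul k)"
    have "h (t - 1) \<in> N" using h unit by (simp add: hom_mod_def t_def)
    then have "cong_mod N (h (t - 1)) 0" by (simp add: cong_mod_def)
    moreover have "cong_mod N (h 1) 1" using h by (simp add: hom_mod_def)
    moreover have "cong_mod N (h t) (h (t - 1) + h 1)" using h_add[of "t - 1" 1] by simp
    ultimately have "cong_mod N (h t) (0 + 1)" using cong_mod_add[OF N] tr by blast
    then show ?thesis by (simp add: t_def)
  qed
  then have "cong_mod N (h (\<Sum>k\<in>Poly_Mapping.keys \<epsilon>. ?x k * unMul k) * v) (1 * v)"
    by (intro mm rf)
  from tr[OF 1 tr[OF 2 this]] show ?thesis by simp
qed

section \<open>Ideals of the tensor square\<close>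

lemma regular_mod_lft:
  assumes R: "is_subring R" and reg: "regular_mod R C"
  shows "regular_mod (lft ` R) (tens_rel R C)"
  unfolding regular_mod_def
proof (intro allI impI)
  fix I assume I: "submod (lft ` R) I" "I \<subseteq> lft ` R" "tens_rel R C \<inter> lft ` R \<subseteq> I"
  let ?I = "{r \<in> R. lft r \<in> I}"
  have "submod R ?I \<Longrightarrow> \<exists>e\<in>?I. \<forall>x\<in>?I. x - e * x \<in> C"
    using reg I(3) lft_tens_rel[of _ C R] unfolding regular_mod_def by blast
  moreover have "submod R ?I"
    using R I(1) by (auto simp: submod_def is_subring_def lft_0 lft_add lft_mult)
  ultimately obtain e where e: "e \<in> ?I" "\<forall>x\<in>?I. x - e * x \<in> C" by blast
  have "y - lft e * y \<in> tens_rel R C" if "y \<in> I" for y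
  proof -
    obtain x where x: "x \<in> ?I" "y = lft x" using \<open>y \<in> I\<close> I(2) by blast
    then have "lft (x - e * x) \<in> tens_rel R C" using e lft_tens_rel by blast
    then show ?thesis by (simp add: x lft_diff lft_mult)
  qed
  then show "\<exists>e\<in>I. \<forall>x\<in>I. x - e * x \<in> tens_rel R C" using e by blast
qed

lemma subring_lft: "is_subring R \<Longrightarrow> is_subring (lft ` R)"
  unfolding is_subring_def
  by (auto simp: lft_add[symmetric] lft_diff[symmetric] lft_mult[symmetric] image_iff
      intro: bexI[of _ 0] bexI[of _ 1] simp: lft_0 lft_1)

lemma regular_mod_tens:
  assumes R: "is_subring R" and C: "submod UNIV C" and CR: "C \<subseteq> R" and reg: "regular_mod R C"
    and sep: "\<And>s. diag s * \<epsilon> \<in> tens_rel R C"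
    and unit: "(\<Sum>k\<in>Poly_Mapping.keys \<epsilon>. Poly_Mapping.lookup \<epsilon> k * unMul k) - 1 \<in> C"
  shows "regular_mod UNIV (tens_rel R C)"
  unfolding regular_mod_def
proof (intro allI impI)
  let ?Q = "tens_rel R C"
  fix H assume H: "submod UNIV H" and "?Q \<inter> UNIV \<subseteq> H"
  then have QH: "?Q \<subseteq> H" by simp
  have Q: "submod UNIV ?Q" by (rule ideal_tens_rel)
  note tr = cong_mod_trans[OF Q] and sy = cong_mod_sym[OF Q] and ml = cong_mod_mult_left[OF Q]
    and mm = cong_mod_mult[OF Q]
  obtain p where p: "\<And>s. p s \<in> H" "\<And>y. y \<in> H \<Longrightarrow> cong_mod ?Q (p y) y"
    "\<And>s t. cong_mod ?Q (p (s + t)) (p s + p t)" "\<And>a s. a \<in> lft ` R \<Longrightarrow> cong_mod ?Q (p (a * s)) (a * p s)"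
    "\<And>n. n \<in> ?Q \<Longrightarrow> p n \<in> ?Q"
    by (rule submod_projection[OF subring_lft[OF R] Q regular_mod_lft[OF R reg] submod_subset[OF H subset_UNIV] QH])
      blast
  have hl: "hom_mod C ?Q lft"
    by (simp add: hom_mod_def lft_add lft_mult lft_1 lft_tens_rel cong_mod_refl[OF Q])
  have hr: "hom_mod C ?Q rgt"
    by (simp add: hom_mod_def rgt_add rgt_mult rgt_1 rgt_tens_rel[OF _ CR] cong_mod_refl[OF Q])
  have lr: "cong_mod ?Q (rgt r) (lft r)" if "r \<in> R" for r
    using diag_tens_rel[OF that] sy by (simp add: cong_mod_def diag_def)
  have p0: "additive_mod ?Q p" using p(3,5) by (simp add: additive_mod_def)
  define q where "q = avg \<epsilon> lft p"
  have q0: "additive_mod ?Q q" unfolding q_def by (rule additive_mod_avg[OF Q p0])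
  have qH: "q v \<in> H" for v unfolding q_def by (rule avg_mem[OF H p(1)])
  have qf: "cong_mod ?Q (q v) v" if "v \<in> H" for v
    unfolding q_def by (rule avg_fix[OF C Q hl H p(2) unit that])
  have ql: "cong_mod ?Q (q (lft s * v)) (lft s * q v)" for s v
    unfolding q_def by (rule avg_linear[OF C Q hl p0 _ sep]) (rule p(4), simp)
  \<comment> \<open>The second averaging starts from linearity over \<open>rgt r\<close> for
    \<open>r\<close> in \<open>R\<close>; this follows from \<open>ql\<close>, as
    \<open>rgt r\<close> and \<open>lft r\<close> agree modulo \<open>?Q\<close>.\<close>
  have qr: "cong_mod ?Q (q (rgt r * v)) (rgt r * q v)" if "r \<in> R" for r v
  proof -
    have "cong_mod ?Q (q (rgt r * v)) (q (lft r * v))"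
      by (intro additive_mod_cong[OF Q q0] mm lr that cong_mod_refl[OF Q])
    moreover have "cong_mod ?Q (rgt r * q v) (lft r * q v)"
      by (intro mm lr that cong_mod_refl[OF Q])
    ultimately show ?thesis using ql tr sy by meson
  qed
  define w where "w = avg \<epsilon> rgt q"
  have w0: "additive_mod ?Q w" unfolding w_def by (rule additive_mod_avg[OF Q q0])
  have wH: "w v \<in> H" for v unfolding w_def by (rule avg_mem[OF H qH])
  have wf: "cong_mod ?Q (w v) v" if "v \<in> H" for v
    unfolding w_def by (rule avg_fix[OF C Q hr H qf unit that])
  have wr: "cong_mod ?Q (w (rgt s * v)) (rgt s * w v)" for s v
    unfolding w_def by (rule avg_linear[OF C Q hr q0 qr sep])
  have wl: "cong_mod ?Q (w (lft s * v)) (lft s * w v)" for s v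
    unfolding w_def by (rule avg_commute[OF Q]) (rule ql)
  have lin: "cong_mod ?Q (w v) (v * w 1)" for v
  proof (induction v rule: tens_induct)
    case (monomial a s)
    have "cong_mod ?Q (w (rgt s)) (rgt s * w 1)" using wr[of s 1] by simp
    then show ?case using tr[OF wl ml] by (simp add: mult.assoc)
  next
    case (add p q)
    have "cong_mod ?Q (w (p + q)) (w p + w q)" using w0 by (simp add: additive_mod_def)
    then show ?case using tr[OF _ cong_mod_add[OF Q add]] by (simp add: distrib_right)
  qed
  have "x - w 1 * x \<in> ?Q" if "x \<in> H" for x
    using tr[OF sy[OF wf[OF that]] lin] by (simp add: cong_mod_def mult.commute)
  then show "\<exists>e\<in>H. \<forall>x\<in>H. x - e * x \<in> ?Q" using wH by blast
qed

text \<open>If the claim fails, Zorn gives an ideal \<open>H\<close> maximal among those with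
  infinitely many ideals above. An idempotent splitting above \<open>H\<close> embeds the ideals
  over \<open>H\<close> into pairs of ideals from two finite families.\<close>

lemma finite_ideals_of_regular_mod:
  fixes Q :: "'a::comm_ring_1 set"
  assumes Q: "submod UNIV Q" and reg: "regular_mod UNIV Q"
  shows "finite {H. submod UNIV H \<and> Q \<subseteq> H}"
proof (rule ccontr)
  let ?up = "\<lambda>H. {G. submod UNIV G \<and> H \<subseteq> G}"
  let ?\<A> = "{H. submod UNIV H \<and> Q \<subseteq> H \<and> infinite (?up H)}"
  have idem: "\<exists>e\<in>H. \<forall>x\<in>H. x - e * x \<in> Q" if "submod UNIV H" "Q \<subseteq> H" for H
    using reg that by (simp add: regular_mod_def)
  assume "infinite {H. submod UNIV H \<and> Q \<subseteq> H}"
  then have QA: "Q \<in> ?\<A>" using Q by simp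
  have "\<exists>H\<in>?\<A>. \<forall>X\<in>?\<A>. H \<subseteq> X \<longrightarrow> X = H"
  proof (rule subset_Zorn_nonempty)
    show "?\<A> \<noteq> {}" using QA by (metis empty_iff)
    show "\<Union>\<C> \<in> ?\<A>" if ne: "\<C> \<noteq> {}" and ch: "subset.chain ?\<A> \<C>" for \<C>
    proof -
      have CA: "V \<in> ?\<A>" if "V \<in> \<C>" for V using ch that unfolding subset.chain_def by (rule subsetD[OF conjunct1])
      have U: "submod UNIV (\<Union>\<C>)" by (rule submod_Union_chain[OF ne ch]) simp
      have "Q \<subseteq> \<Union>\<C>" using ne CA by blast
      then obtain e where e: "e \<in> \<Union>\<C>" "\<forall>x\<in>\<Union>\<C>. x - e * x \<in> Q" using idem[OF U] by blast
      then obtain V where V: "V \<in> \<C>" "e \<in> V" by blast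
      have VI: "submod UNIV V" "Q \<subseteq> V" using CA[OF V(1)] by auto
      \<comment> \<open>The generator of the union already lies in the member \<open>V\<close>, so
        the chain has a largest member and the upper bound stays in \<open>?\<A>\<close>.\<close>
      have "\<Union>\<C> \<subseteq> V"
      proof
        fix x assume "x \<in> \<Union>\<C>"
        then have "(x - e * x) + e * x \<in> V"
          using e VI V by (intro submod_add[OF VI(1)] ideal_mult_right[OF VI(1)]) auto
        then show "x \<in> V" by simp
      qed
      then have "\<Union>\<C> = V" using V(1) by blast
      then show ?thesis using CA[OF V(1)] by simp
    qed
  qed
  then obtain H where HA: "H \<in> ?\<A>" and max: "\<forall>X\<in>?\<A>. H \<subseteq> X \<longrightarrow> X = H" by (rule bexE)
  have H: "submod UNIV H" "Q \<subseteq> H" "infinite (?up H)" using HA by auto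
  have fin: "finite (?up X)" if "submod UNIV X" "H \<subset> X" for X
  proof (rule ccontr)
    assume "infinite (?up X)"
    then have "X \<in> ?\<A>" using that H by auto
    then show False using max that by blast
  qed
  show False
  proof (cases "\<exists>I. submod UNIV I \<and> H \<subset> I \<and> I \<subset> UNIV")
    case False
    then have "?up H \<subseteq> {H, UNIV}" by blast
    then show False using H(3) finite_subset[of "?up H" "{H, UNIV}"] by simp
  next
    case True
    then obtain I where I: "submod UNIV I" "H \<subset> I" "I \<subset> UNIV" by blast
    obtain f where f: "f \<in> I" "\<And>x. x \<in> I \<Longrightarrow> x - f * x \<in> Q" using idem[OF I(1)] I(2) H(2) by blast
    \<comment> \<open>The complementary ideal to \<open>I\<close> above \<open>H\<close>. It is
      strictly larger than \<open>H\<close>, since \<open>1 - f\<close> in \<open>H\<close> would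
      force \<open>I\<close> to be everything.\<close>
    let ?K = "{x + y |x y. x \<in> H \<and> y \<in> {a * (1 - f) |a. a \<in> UNIV}}"
    have K: "submod UNIV ?K" by (intro submod_plus H submod_multiples is_subring_UNIV)
    have HK: "H \<subseteq> ?K" using submod_0[OF submod_multiples[OF is_subring_UNIV]] by force
    have "1 - f = 0 + 1 * (1 - f)" by simp
    then have fK: "1 - f \<in> ?K" using submod_0[OF H(1)] by blast
    have "1 - f \<notin> H"
    proof
      assume "1 - f \<in> H"
      then have "(1 - f) + f \<in> I" using f(1) I(2) submod_add[OF I(1)] by blast
      then have "a * 1 \<in> I" for a using ideal_mult[OF I(1), of 1 a] by simp
      then show False using I(3) by auto
    qed
    then have HK': "H \<subset> ?K" using HK fK by blast
    have sub: "?up H \<subseteq> (\<lambda>(X, Y). X \<inter> Y) ` (?up I \<times> ?up ?K)"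
    proof
      fix G assume "G \<in> ?up H"
      then have G: "submod UNIV G" "H \<subseteq> G" by auto
      have QG: "Q \<subseteq> G" using H(2) G(2) by blast
      let ?X = "{x + y |x y. x \<in> G \<and> y \<in> I}" and ?Y = "{x + y |x y. x \<in> G \<and> y \<in> ?K}"
      have "?X \<in> ?up I" using submod_plus[OF G(1) I(1)] submod_0[OF G(1)] by force
      moreover have "?Y \<in> ?up ?K"
      proof -
        have "x \<in> ?Y" if "x \<in> ?K" for x
        proof -
          have "x = 0 + x" by simp
          then show ?thesis using submod_0[OF G(1)] that by blast
        qed
        then show ?thesis using submod_plus[OF G(1) K] by blast
      qed
      moreover have "G = ?X \<inter> ?Y"
      proof
        show "G \<subseteq> ?X \<inter> ?Y"
        proof
          fix x assume "x \<in> G"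
          moreover have "x = x + 0" by simp
          ultimately show "x \<in> ?X \<inter> ?Y" using submod_0[OF I(1)] submod_0[OF K] by blast
        qed
        show "?X \<inter> ?Y \<subseteq> G"
        proof
          fix x assume x: "x \<in> ?X \<inter> ?Y"
          obtain g i where gi: "g \<in> G" "i \<in> I" "x = g + i" using x by blast
          obtain g' k a where gk: "g' \<in> G" "k \<in> H" "x = g' + (k + a * (1 - f))" using x by blast
          have "f - f * f \<in> G" using f QG by blast
          \<comment> \<open>Splits \<open>x\<close> as \<open>(1 - f) * x + f * x\<close>, using the
            expression through \<open>I\<close> for the first summand and the one through
            \<open>?K\<close> for the second.\<close>
          then have "(1 - f) * g + (i - f * i) + (f * g' + f * k + a * (f - f * f)) \<in> G"
            using gi gk f(2)[OF gi(2)] QG G(2)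
            by (intro submod_add[OF G(1)] ideal_mult[OF G(1)]) auto
          moreover have "(1 - f) * g + (i - f * i) + (f * g' + f * k + a * (f - f * f))
              = (1 - f) * (g + i) + f * (g' + (k + a * (1 - f)))"
            by (simp add: algebra_simps)
          moreover have "\<dots> = (1 - f) * x + f * x" using gi gk by simp
          moreover have "\<dots> = x" by (simp add: algebra_simps)
          ultimately show "x \<in> G" by simp
        qed
      qed
      ultimately show "G \<in> (\<lambda>(X, Y). X \<inter> Y) ` (?up I \<times> ?up ?K)"
        by (intro image_eqI[of _ _ "(?X, ?Y)"]) (simp, rule SigmaI)
    qed
    have "finite (?up I \<times> ?up ?K)"
      by (rule finite_cartesian_product[OF fin[OF I(1,2)] fin[OF K HK']])
    then have "finite (?up H)" by (rule finite_subset[OF sub finite_imageI])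
    then show False using H(3) by (rule notE[rotated])
  qed
qed

section \<open>Finitely generated modules\<close>

text \<open>A submodule is controlled by its coefficients at the generator \<open>f\<close> and its
  intersection with the span of the remaining generators. Once both descending sequences are
  stationary, so is \<open>V\<close>.\<close>

lemma fin_gen_dcc:
  fixes R :: "'a::comm_ring_1 set" and V :: "nat \<Rightarrow> 'a set"
  assumes R: "is_subring R" and C: "submod UNIV C" and CR: "C \<subseteq> R"
    and dcc: "\<And>I :: nat \<Rightarrow> 'a set. (\<And>n. submod R (I n) \<and> C \<subseteq> I n \<and> I n \<subseteq> R \<and> I (Suc n) \<subseteq> I n)
      \<Longrightarrow> \<exists>m. \<forall>n\<ge>m. I n = I m"
    and "finite F" "\<And>n. submod R (V n)" "\<And>n. C \<subseteq> V n" "\<And>n. V n \<subseteq> mspan R (F \<union> C)" "\<And>n. V (Suc n) \<subseteq> V n"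
  shows "\<exists>m. \<forall>n\<ge>m. V n = V m"
  using assms(5-)
proof (induction F arbitrary: V rule: finite_induct)
  case empty
  have "mspan R ({} \<union> C) \<subseteq> C" by (rule mspan_minimal[OF submod_subset[OF C subset_UNIV]]) simp
  then have "V n = C" for n using empty.prems(2,3)[of n] by blast
  then show ?case by simp
next
  case (insert f F)
  let ?M = "mspan R (F \<union> C)"
  have M: "submod R ?M" by (rule submod_mspan)
  define I where "I n = {r \<in> R. \<exists>m\<in>?M. r * f + m \<in> V n}" for n
  have "\<exists>m. \<forall>n\<ge>m. I n = I m"
  proof (rule dcc, intro conjI)
    fix n
    note Vn = insert.prems(1)[of n]
    show "submod R (I n)"
      unfolding submod_def
    proof (intro conjI ballI)
      show "0 \<in> I n" using R submod_0[OF M] submod_0[OF Vn] by (force simp: I_def is_subring_def)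
    next
      fix x y assume "x \<in> I n" "y \<in> I n"
      then obtain a b where ab: "x \<in> R" "y \<in> R" "a \<in> ?M" "b \<in> ?M" "x * f + a \<in> V n" "y * f + b \<in> V n"
        unfolding I_def by blast
      have "(x * f + a) + (y * f + b) \<in> V n" using ab submod_add[OF Vn] by blast
      then have "(x + y) * f + (a + b) \<in> V n" by (simp add: algebra_simps)
      moreover have "a + b \<in> ?M" using ab submod_add[OF M] by blast
      moreover have "x + y \<in> R" using ab R by (simp add: is_subring_def)
      ultimately show "x + y \<in> I n" unfolding I_def by blast
    next
      fix r x assume r: "r \<in> R" and "x \<in> I n"
      then obtain a where a: "x \<in> R" "a \<in> ?M" "x * f + a \<in> V n" unfolding I_def by blast
      have "r * (x * f + a) \<in> V n" using a r submod_mult[OF Vn] by blast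
      then have "(r * x) * f + r * a \<in> V n" by (simp add: algebra_simps)
      moreover have "r * a \<in> ?M" using a r submod_mult[OF M] by blast
      moreover have "r * x \<in> R" using a r R by (simp add: is_subring_def)
      ultimately show "r * x \<in> I n" unfolding I_def by blast
    qed
    show "C \<subseteq> I n"
    proof
      fix c assume c: "c \<in> C"
      then have "c * f + 0 \<in> V n" using ideal_mult_right[OF C] insert.prems(2) by auto
      then show "c \<in> I n" unfolding I_def using c CR submod_0[OF M] by blast
    qed
    show "I n \<subseteq> R" by (auto simp: I_def)
    show "I (Suc n) \<subseteq> I n" using insert.prems(4)[of n] by (auto simp: I_def)
  qed
  then obtain m1 where m1: "\<And>n. n \<ge> m1 \<Longrightarrow> I n = I m1" by blast
  have "\<exists>m. \<forall>n\<ge>m. V n \<inter> ?M = V m \<inter> ?M"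
  proof (rule insert.IH)
    fix n
    show "submod R (V n \<inter> ?M)" by (intro submod_Int insert.prems M)
    show "C \<subseteq> V n \<inter> ?M" using insert.prems(2) mspan_superset by blast
    show "V n \<inter> ?M \<subseteq> ?M" by blast
    show "V (Suc n) \<inter> ?M \<subseteq> V n \<inter> ?M" using insert.prems(4) by blast
  qed
  then obtain m2 where m2: "\<And>n. n \<ge> m2 \<Longrightarrow> V n \<inter> ?M = V m2 \<inter> ?M" by blast
  define m where "m = max m1 m2"
  have dec: "V n \<subseteq> V m" if "n \<ge> m" for n
    using that by (induction rule: dec_induct) (use insert.prems(4) in blast)+
  have "V n = V m" if n: "n \<ge> m" for n
  proof
    show "V n \<subseteq> V m" by (rule dec[OF n])
    show "V m \<subseteq> V n"
    proof
      fix x assume x: "x \<in> V m"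
      then have "x \<in> mspan R (insert f (F \<union> C))" using insert.prems(3) by auto
      then obtain r a where ra: "r \<in> R" "a \<in> ?M" "x = r * f + a" by (rule mspan_insert[OF R])
      then have "r \<in> I m" using x unfolding I_def by blast
      moreover have "I m = I n" using m1[of m] m1[of n] n by (simp add: m_def)
      ultimately obtain b where b: "b \<in> ?M" "r * f + b \<in> V n" unfolding I_def by blast
      have "x - (r * f + b) \<in> V m"
        using x b dec[OF n] by (intro submod_diff[OF R insert.prems(1)]) auto
      moreover have "x - (r * f + b) = a - b" using ra by simp
      moreover have "a - b \<in> ?M" using ra b by (intro submod_diff[OF R M])
      ultimately have "a - b \<in> V m \<inter> ?M" by simp
      moreover have "V m \<inter> ?M = V n \<inter> ?M" using m2[of m] m2[of n] n by (simp add: m_def)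
      ultimately have "a - b \<in> V n" by blast
      then have "(a - b) + (r * f + b) \<in> V n" using b submod_add[OF insert.prems(1)] by blast
      then show "x \<in> V n" using ra by (simp add: add.commute)
    qed
  qed
  then show ?case by blast
qed

text \<open>Adding the single generator 1 accounts for all of \<open>C\<close>, because
  \<open>C\<close> lies in \<open>R\<close>.\<close>

lemma finite_ext_if_mspan:
  assumes R: "is_subring R" and CR: "C \<subseteq> R" and F: "finite F" and span: "mspan R (F \<union> C) = UNIV"
  shows "finite_ext R"
proof -
  let ?F = "insert 1 F"
  let ?V = "{s. \<exists>c. (\<forall>f\<in>?F. c f \<in> R) \<and> s = (\<Sum>f\<in>?F. c f * f)}"
  have RI: "0 \<in> R" "1 \<in> R" "\<And>x y. x \<in> R \<Longrightarrow> y \<in> R \<Longrightarrow> x + y \<in> R" "\<And>x y. x \<in> R \<Longrightarrow> y \<in> R \<Longrightarrow> x * y \<in> R"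
    using R by (auto simp: is_subring_def)
  have single: "r * f \<in> ?V" if "r \<in> R" "f \<in> ?F" for r f
  proof -
    have "(\<Sum>g\<in>?F. (if g = f then r else 0) * g) = (\<Sum>g\<in>?F. if g = f then r * f else 0)"
      by (rule sum.cong) auto
    also have "\<dots> = r * f" using F that by (simp only: sum.delta finite_insert if_True)
    finally have "r * f = (\<Sum>g\<in>?F. (if g = f then r else 0) * g)" by simp
    moreover have "\<forall>g\<in>?F. (if g = f then r else 0) \<in> R" using that RI by simp
    ultimately show ?thesis
      by (intro CollectI exI[of _ "\<lambda>g. if g = f then r else 0"] conjI)
  qed
  have "submod R ?V"
    unfolding submod_def
  proof (intro conjI ballI)
    show "0 \<in> ?V" using single[of 0 1] RI by simp
  next
    fix x y assume "x \<in> ?V" "y \<in> ?V"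
    then obtain c d where "\<forall>f\<in>?F. c f \<in> R" "\<forall>f\<in>?F. d f \<in> R"
      "x = (\<Sum>f\<in>?F. c f * f)" "y = (\<Sum>f\<in>?F. d f * f)" by blast
    then have "\<forall>f\<in>?F. c f + d f \<in> R" "x + y = (\<Sum>f\<in>?F. (c f + d f) * f)"
      using RI by (auto simp only: distrib_right sum.distrib)
    then show "x + y \<in> ?V" by (intro CollectI exI[of _ "\<lambda>f. c f + d f"]) simp
  next
    fix r x assume "r \<in> R" "x \<in> ?V"
    then obtain c where "\<forall>f\<in>?F. c f \<in> R" "x = (\<Sum>f\<in>?F. c f * f)" by blast
    then have "\<forall>f\<in>?F. r * c f \<in> R" and "r * x = (\<Sum>f\<in>?F. r * c f * f)"
      using RI(4)[OF \<open>r \<in> R\<close>] by (blast, simp only: sum_distrib_left mult.assoc)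
    then show "r * x \<in> ?V" by (intro CollectI exI[of _ "\<lambda>f. r * c f"]) simp
  qed
  moreover have "F \<union> C \<subseteq> ?V"
  proof
    fix x assume "x \<in> F \<union> C"
    then show "x \<in> ?V"
      using single[of 1 x] single[of x 1] RI CR by auto
  qed
  ultimately have "mspan R (F \<union> C) \<subseteq> ?V" by (rule mspan_minimal)
  then have "s \<in> ?V" for s using span by blast
  then show ?thesis unfolding finite_ext_def using F by (intro exI[of _ ?F]) auto
qed

section \<open>The nucleus\<close>

lemma conductor_ideal:
  assumes "is_subring R" shows "submod UNIV (conductor R)"
  using assms by (auto simp: submod_def conductor_def is_subring_def distrib_right mult.assoc)
    (metis mult.assoc mult.commute)+

lemma conductor_subset: "conductor R \<subseteq> R"
  by (auto simp: conductor_def)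

lemma cring_ring_of:
  assumes "is_subring R" shows "cring (ring_of R)"
proof (rule cringI)
  show "abelian_group (ring_of R)"
    by (rule abelian_groupI)
      (use assms subring_uminus[OF assms] in \<open>auto simp: ring_of_def is_subring_def algebra_simps intro: bexI[of _ "- _"]\<close>)
  show "Group.comm_monoid (ring_of R)"
    by (rule comm_monoidI) (use assms in \<open>auto simp: ring_of_def is_subring_def algebra_simps\<close>)
qed (auto simp: ring_of_def algebra_simps)

lemma ideal_ring_of:
  assumes R: "is_subring R" and I: "submod R I" "I \<subseteq> R"
  shows "ideal I (ring_of R)"
proof (rule idealI)
  interpret cring "ring_of R" by (rule cring_ring_of[OF R])
  show "ring (ring_of R)" by (rule ring_axioms)
  show "subgroup I (add_monoid (ring_of R))"
  proof (rule add.subgroupI)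
    show "I \<subseteq> carrier (ring_of R)" using I by (simp add: ring_of_def)
    show "I \<noteq> {}" using submod_0[OF I(1)] by blast
    show "\<ominus>\<^bsub>ring_of R\<^esub> a \<in> I" if a: "a \<in> I" for a
    proof -
      have "\<ominus>\<^bsub>ring_of R\<^esub> a = - a"
        by (rule minus_equality) (use a I subring_uminus[OF R] in \<open>auto simp: ring_of_def\<close>)
      then show ?thesis using submod_uminus[OF R I(1) a] by simp
    qed
    show "a \<oplus>\<^bsub>ring_of R\<^esub> b \<in> I" if "a \<in> I" "b \<in> I" for a b
      using submod_add[OF I(1) that] by (simp add: ring_of_def)
  qed
  show "x \<otimes>\<^bsub>ring_of R\<^esub> a \<in> I" if "a \<in> I" "x \<in> carrier (ring_of R)" for a x
    using submod_mult[OF I(1)] that by (simp add: ring_of_def)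
  show "a \<otimes>\<^bsub>ring_of R\<^esub> x \<in> I" if "a \<in> I" "x \<in> carrier (ring_of R)" for a x
    using submod_mult[OF I(1), of x a] that by (simp add: ring_of_def mult.commute)
qed

text \<open>The chain is pushed to the quotient, where it becomes stationary; the correspondence of
  ideals above the conductor is injective, which brings equality back.\<close>

lemma artinian_nucleus_dcc:
  fixes I :: "nat \<Rightarrow> 'a::comm_ring_1 set"
  assumes R: "is_subring R" and art: "artinian (nucleus R)"
    and I: "\<And>n. submod R (I n) \<and> conductor R \<subseteq> I n \<and> I n \<subseteq> R \<and> I (Suc n) \<subseteq> I n"
  shows "\<exists>m. \<forall>n\<ge>m. I n = I m"
proof -
  interpret cring "ring_of R" by (rule cring_ring_of[OF R])
  let ?C = "conductor R"
  let ?q = "\<lambda>J. (\<lambda>x. ?C +>\<^bsub>ring_of R\<^esub> x) ` J"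
  have C: "ideal ?C (ring_of R)"
    by (rule ideal_ring_of[OF R submod_subset[OF conductor_ideal[OF R] subset_UNIV] conductor_subset])
  have II: "ideal (I n) (ring_of R)" for n using I[of n] by (intro ideal_ring_of[OF R]) auto
  have "\<forall>n. ideal (?q (I n)) (nucleus R) \<and> ?q (I (Suc n)) \<subseteq> ?q (I n)"
    using ring_ideal_imp_quot_ideal[OF C II] I unfolding nucleus_def by (meson image_mono)
  then have "\<exists>m. \<forall>n\<ge>m. ?q (I n) = ?q (I m)"
    using art[unfolded artinian_def, THEN conjunct2, THEN spec, of "\<lambda>n. ?q (I n)"] by (rule rev_mp)
  then obtain m where m: "\<forall>n\<ge>m. ?q (I n) = ?q (I m)" ..
  have inj: "inj_on ?q {J. ideal J (ring_of R) \<and> ?C \<subseteq> J}"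
    using quot_ideal_correspondence[OF C] by (rule bij_betw_imp_inj_on)
  have "I n = I m" if "n \<ge> m" for n
  proof (rule inj_onD[OF inj])
    show "?q (I n) = ?q (I m)" by (rule m[rule_format, OF \<open>n \<ge> m\<close>])
    show "I n \<in> {J. ideal J (ring_of R) \<and> ?C \<subseteq> J}" using II[of n] I[of n] by simp
    show "I m \<in> {J. ideal J (ring_of R) \<and> ?C \<subseteq> J}" using II[of m] I[of m] by simp
  qed
  then show ?thesis by blast
qed

lemma reduced_nucleus_power:
  assumes R: "is_subring R" and red: "reduced (nucleus R)" and x: "x \<in> R" "x ^ n \<in> conductor R"
  shows "x \<in> conductor R"
proof -
  let ?C = "conductor R"
  have zero: "\<zero>\<^bsub>nucleus R\<^esub> = ?C" unfolding nucleus_def FactRing_def by simp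
  interpret cring "ring_of R" by (rule cring_ring_of[OF R])
  let ?q = "\<lambda>x. ?C +>\<^bsub>ring_of R\<^esub> x"
  have C: "ideal ?C (ring_of R)"
    by (rule ideal_ring_of[OF R submod_subset[OF conductor_ideal[OF R] subset_UNIV] conductor_subset])
  interpret Ci: ideal ?C "ring_of R" by (rule C)
  have hom: "ring_hom_ring (ring_of R) (nucleus R) ?q"
    unfolding nucleus_def by (rule Ci.rcos_ring_hom_ring)
  interpret q: ring_hom_ring "ring_of R" "nucleus R" ?q by (rule hom)
  have car: "carrier (ring_of R) = R" by (simp add: ring_of_def)
  have pow: "y [^]\<^bsub>ring_of R\<^esub> n = y ^ n" for y and n :: nat
    by (induction n) (simp_all add: ring_of_def nat_pow_def mult.commute)
  have ker: "?q y = ?C \<longleftrightarrow> y \<in> ?C" if "y \<in> R" for y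
    using Ci.a_rcos_const[of y] Ci.a_rcos_self[of y] that car by auto
  have "?q x [^]\<^bsub>nucleus R\<^esub> n = ?q (x ^ n)"
    using q.hom_nat_pow[of x n] x(1) by (simp add: car pow)
  also have "\<dots> = \<zero>\<^bsub>nucleus R\<^esub>" using ker[of "x ^ n"] x(2) subring_power[OF R x(1)] zero by simp
  finally have "?q x = \<zero>\<^bsub>nucleus R\<^esub>"
    using red q.hom_closed[of x] x(1) unfolding reduced_def car by blast
  then show ?thesis using ker[OF x(1)] zero by simp
qed

section \<open>Finiteness and intermediate rings\<close>

context
  fixes R C :: "'a::comm_ring_1 set" and \<epsilon> :: "'a tens"
  assumes R: "is_subring R" and C: "submod UNIV C" and CR: "C \<subseteq> R" and reg: "regular_mod R C"
    and sep: "\<And>s. diag s * \<epsilon> \<in> tens_rel R C"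
    and unit: "(\<Sum>k\<in>Poly_Mapping.keys \<epsilon>. Poly_Mapping.lookup \<epsilon> k * unMul k) - 1 \<in> C"
begin

lemma balanced_projection:
  assumes "\<And>s t. cong_mod C (p (s + t)) (p s + p t)"
    and "\<And>a s. a \<in> A \<Longrightarrow> cong_mod C (p (a * s)) (a * p s)"
  shows "balanced A C C (\<lambda>x y. x * p y)"
  unfolding balanced_def
proof (intro conjI allI ballI)
  show "cong_mod C ((x + x') * p y) (x * p y + x' * p y)" for x x' y
    by (simp add: distrib_right cong_mod_refl[OF C])
  show "cong_mod C (x * p (y + y')) (x * p y + x * p y')" for x y y'
    using cong_mod_mult_left[OF C assms(1), of x y y'] by (simp add: distrib_left)
  show "cong_mod C (r * x * p y) (x * p (r * y))" if "r \<in> A" for r x y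
    using cong_mod_sym[OF C cong_mod_mult_left[OF C assms(2)[OF that, of y], of x]]
    by (simp add: ac_simps)
  show "c * p y \<in> C" if "c \<in> C" for c y using that by (rule ideal_mult_right[OF C])
qed

text \<open>The projection \<open>p\<close> confines all the elements \<open>p (s * unMul k)\<close>
  to one finitely generated module modulo \<open>C\<close>, whatever \<open>s\<close> is.\<close>

lemma separable_fin_gen:
  obtains F where "finite F" "mspan R (F \<union> C) = UNIV"
proof -
  let ?K = "Poly_Mapping.keys \<epsilon>" and ?x = "Poly_Mapping.lookup \<epsilon>"
  let ?Y = "mspan R (unMul ` ?K \<union> C)"
  \<comment> \<open>The indices vary independently, since \<open>p (s * unMul k)\<close> may involve
    every \<open>unMul l\<close>.\<close>
  define F where "F = (\<lambda>(k, l). ?x k * unMul l) ` (?K \<times> ?K)"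
  let ?S = "mspan R (F \<union> C)"
  have S: "submod R ?S" by (rule submod_mspan)
  have CS: "C \<subseteq> ?S" and CY: "C \<subseteq> ?Y" using mspan_superset by blast+
  obtain p where p: "\<And>s. p s \<in> ?Y" "\<And>y. y \<in> ?Y \<Longrightarrow> cong_mod C (p y) y"
    "\<And>s t. cong_mod C (p (s + t)) (p s + p t)" "\<And>a s. a \<in> R \<Longrightarrow> cong_mod C (p (a * s)) (a * p s)"
    by (rule submod_projection[OF R C reg submod_mspan CY]) blast
  have xY: "?x k * y \<in> ?S" if k: "k \<in> ?K" and "y \<in> ?Y" for k y
  proof -
    have "submod R {y. ?x k * y \<in> ?S}"
      using S by (auto simp: submod_def distrib_left mult.left_commute[of "?x k"])
    moreover have "unMul ` ?K \<union> C \<subseteq> {y. ?x k * y \<in> ?S}"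
    proof -
      have "?x k * unMul l \<in> ?S" if "l \<in> ?K" for l
        using k that by (intro mspan_base) (auto simp: F_def)
      then show ?thesis using CS ideal_mult[OF C] by blast
    qed
    ultimately have "?Y \<subseteq> {y. ?x k * y \<in> ?S}" by (rule mspan_minimal)
    then show ?thesis using that by blast
  qed
  have "s \<in> ?S" for s
  proof -
    have "cong_mod C (\<Sum>k\<in>?K. s * ?x k * p (unMul k)) (\<Sum>k\<in>?K. ?x k * p (s * unMul k))"
      using balanced_separability[OF C C balanced_projection[OF p(3,4)] sep[of s]] by simp
    moreover have "cong_mod C (\<Sum>k\<in>?K. s * ?x k * p (unMul k)) (\<Sum>k\<in>?K. s * ?x k * unMul k)"
      by (intro cong_mod_sum[OF C] cong_mod_mult_left[OF C] p(2) mspan_base) simp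
    moreover have "cong_mod C (\<Sum>k\<in>?K. s * ?x k * unMul k) s"
      using cong_mod_mult_left[OF C, of "\<Sum>k\<in>?K. ?x k * unMul k" 1 s] unit
      by (simp add: cong_mod_def sum_distrib_left mult.assoc)
    ultimately have "cong_mod C s (\<Sum>k\<in>?K. ?x k * p (s * unMul k))"
      using cong_mod_trans[OF C] cong_mod_sym[OF C] by meson
    moreover have "(\<Sum>k\<in>?K. ?x k * p (s * unMul k)) \<in> ?S"
      by (intro submod_sum[OF S] xY p)
    ultimately show ?thesis by (rule cong_mod_mem[OF C S CS])
  qed
  then have "?S = UNIV" by blast
  moreover have "finite F" by (simp add: F_def)
  ultimately show ?thesis by (rule that[rotated])
qed

text \<open>In the tensor square \<open>lft s\<close> is congruent to a multiple of its own square;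
  iterating, it is congruent to a multiple of \<open>lft s ^ n\<close> and so vanishes.
  Multiplication brings the conclusion back to \<open>S\<close>. This supplies reducedness of
  \<open>T/C\<close> for intermediate rings \<open>T\<close>.\<close>

lemma separable_reduced:
  assumes "s ^ n \<in> C"
  shows "s \<in> C"
proof -
  let ?Q = "tens_rel R C"
  let ?H = "{v + w |v w. v \<in> {a * lft s |a. a \<in> UNIV} \<and> w \<in> ?Q}"
  have Q: "submod UNIV ?Q" by (rule ideal_tens_rel)
  have H: "submod UNIV ?H" by (intro submod_plus submod_multiples is_subring_UNIV Q)
  have QH: "?Q \<subseteq> ?H" using submod_0[OF submod_multiples[OF is_subring_UNIV]] by force
  have "lft s = 1 * lft s + 0" by simp
  then have sH: "lft s \<in> ?H" using submod_0[OF Q] by blast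
  have "\<exists>e\<in>?H. \<forall>x\<in>?H. x - e * x \<in> ?Q"
    using regular_mod_tens[OF R C CR reg sep unit, unfolded regular_mod_def, rule_format, OF H] QH
    by blast
  then obtain e where e: "e \<in> ?H" "lft s - e * lft s \<in> ?Q" using sH by blast
  then obtain a q where aq: "e = a * lft s + q" "q \<in> ?Q" by blast
  have step: "cong_mod ?Q (lft s) (a * lft s * lft s)"
  proof -
    have "(lft s - e * lft s) + q * lft s \<in> ?Q"
      using e aq by (intro submod_add[OF Q] ideal_mult_right[OF Q])
    then show ?thesis by (simp add: cong_mod_def aq algebra_simps)
  qed
  have "cong_mod ?Q (lft s) (a ^ n * lft s ^ n * lft s)" for n
  proof (induction n)
    case 0
    then show ?case by (simp add: cong_mod_refl[OF Q])
  next
    case (Suc n)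
    have "cong_mod ?Q (a ^ n * lft s ^ n * lft s) (a ^ n * lft s ^ n * (a * lft s * lft s))"
      by (rule cong_mod_mult_left[OF Q step])
    from cong_mod_trans[OF Q Suc this] show ?case by (simp add: ac_simps)
  qed
  moreover have "a ^ n * lft s ^ n * lft s \<in> ?Q"
    using lft_tens_rel[OF assms, of R] by (intro ideal_mult_right[OF Q] ideal_mult[OF Q]) (simp add: lft_power)
  ultimately have "lft s \<in> ?Q" using cong_mod_mem[OF Q Q subset_refl] by blast
  moreover have bal: "balanced R C C (\<lambda>x y. x * y)"
    by (rule balanced_projection) (simp_all add: cong_mod_refl[OF C])
  ultimately have "ev (\<lambda>x y. x * y) (lft s) \<in> C" by (intro ev_tens_rel[OF C C bal])
  moreover have "cong_mod C (ev (\<lambda>x y. x * y) (lft s)) (s * 1)"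
    using ev_single[OF C C bal, of 0 s] by (simp add: lft_def zero_mul_def)
  ultimately show ?thesis
    using cong_mod_mem[OF C C subset_refl cong_mod_sym[OF C]] by fastforce
qed

text \<open>\<open>T\<close> is recovered from \<open>tens_rel T C\<close>, one of the finitely many
  ideals above \<open>tens_rel R C\<close>.\<close>

lemma separable_FIP:
  assumes dcc: "\<And>I :: nat \<Rightarrow> 'a set. (\<And>n. submod R (I n) \<and> C \<subseteq> I n \<and> I n \<subseteq> R \<and> I (Suc n) \<subseteq> I n)
      \<Longrightarrow> \<exists>m. \<forall>n\<ge>m. I n = I m"
  shows "FIP R"
proof -
  have T: "T = {b. diag b \<in> tens_rel T C}" if T: "is_subring T" "R \<subseteq> T" for T
  proof
    show "T \<subseteq> {b. diag b \<in> tens_rel T C}" using diag_tens_rel by blast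
    show "{b. diag b \<in> tens_rel T C} \<subseteq> T"
    proof
      fix b assume b: "b \<in> {b. diag b \<in> tens_rel T C}"
      have CT: "C \<subseteq> T" using CR T(2) by blast
      \<comment> \<open>Ideals of \<open>T\<close> containing \<open>C\<close> are in particular
        \<open>R\<close>-submodules of \<open>S\<close>, which is finitely generated over
        \<open>R\<close> modulo \<open>C\<close>; this gives the chain condition.\<close>
      have "regular_mod T C"
      proof (rule dcc_reduced_regular_mod[OF T(1) C])
        obtain F where F: "finite F" "mspan R (F \<union> C) = UNIV" by (rule separable_fin_gen)
        fix I :: "nat \<Rightarrow> 'a set"
        assume I: "\<And>n. submod T (I n) \<and> C \<inter> T \<subseteq> I n \<and> I n \<subseteq> T \<and> I (Suc n) \<subseteq> I n"
        show "\<exists>m. \<forall>n\<ge>m. I n = I m"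
        proof (rule fin_gen_dcc[OF R C CR dcc F(1)])
          fix n
          show "submod R (I n)" using I[of n] T(2) submod_subset by blast
          show "C \<subseteq> I n" using I[of n] CT by blast
          show "I n \<subseteq> mspan R (F \<union> C)" using F(2) by blast
          show "I (Suc n) \<subseteq> I n" using I[of n] by blast
        qed
      qed (rule separable_reduced)
      then obtain p where p: "\<And>s. p s \<in> T" "\<And>y. y \<in> T \<Longrightarrow> cong_mod C (p y) y"
        "\<And>s t. cong_mod C (p (s + t)) (p s + p t)" "\<And>a s. a \<in> T \<Longrightarrow> cong_mod C (p (a * s)) (a * p s)"
        by (rule submod_projection[OF T(1) C _ subring_submod[OF T(1)] CT]) blast
      \<comment> \<open>Evaluating \<open>diag b\<close> by this map compares
        \<open>b * p 1\<close>, congruent to \<open>b\<close>, with \<open>p b\<close>, which lies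
        in \<open>T\<close>. As \<open>C\<close> is contained in \<open>T\<close>, this puts
        \<open>b\<close> in \<open>T\<close>.\<close>
      let ?\<beta> = "\<lambda>x y. x * p y"
      have bal: "balanced T C C ?\<beta>" by (rule balanced_projection[OF p(3,4)])
      have "1 \<in> T" using T(1) by (simp add: is_subring_def)
      have "cong_mod C (ev ?\<beta> (lft b)) (b * p 1)"
        using ev_single[OF C C bal, of 0 b] by (simp add: lft_def zero_mul_def)
      moreover have "cong_mod C (b * p 1) (b * 1)"
        by (rule cong_mod_mult_left[OF C p(2)[OF \<open>1 \<in> T\<close>]])
      moreover have "cong_mod C (ev ?\<beta> (rgt b)) (p b)"
        using ev_single[OF C C bal, of "Mul b" 1] by (simp add: rgt_def)
      moreover have "cong_mod C (ev ?\<beta> (lft b)) (ev ?\<beta> (rgt b))"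
      proof -
        have "ev ?\<beta> (diag b) \<in> C" using b by (intro ev_tens_rel[OF C C bal]) simp
        then show ?thesis
          unfolding diag_def cong_mod_def
          by (rule cong_mod_mem[OF C C subset_refl cong_mod_sym[OF C ev_diff[OF C C bal]]])
      qed
      ultimately have "cong_mod C (b * 1) (p b)"
        using cong_mod_trans[OF C] cong_mod_sym[OF C] by meson
      then show "b \<in> T"
        using cong_mod_mem[OF C subring_submod[OF T(1)] CT _ p(1)] by simp
    qed
  qed
  have "finite {H. submod UNIV H \<and> tens_rel R C \<subseteq> H}"
    by (rule finite_ideals_of_regular_mod[OF ideal_tens_rel regular_mod_tens[OF R C CR reg sep unit]])
  then have "finite ((\<lambda>H. {b. diag b \<in> H}) ` {H. submod UNIV H \<and> tens_rel R C \<subseteq> H})" by simp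
  moreover have "{T. is_subring T \<and> R \<subseteq> T} \<subseteq> (\<lambda>H. {b. diag b \<in> H}) ` {H. submod UNIV H \<and> tens_rel R C \<subseteq> H}"
  proof
    fix T assume "T \<in> {T. is_subring T \<and> R \<subseteq> T}"
    then show "T \<in> (\<lambda>H. {b. diag b \<in> H}) ` {H. submod UNIV H \<and> tens_rel R C \<subseteq> H}"
      using T[of T] ideal_tens_rel[of T C] tens_rel_mono[of R T C]
      by (intro image_eqI[of _ _ "tens_rel T C"]) auto
  qed
  ultimately show ?thesis unfolding FIP_def by (rule finite_subset[rotated])
qed

end

theorem theorem3p8:
  fixes R :: "'a::comm_ring_1 set"
  assumes "is_subring R"
    and "R \<noteq> UNIV"
    and "unramified R"
    and "gilmer_ext R"
    and "reduced (nucleus R)"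
  shows "finite_ext R \<and> FIP R"
proof -
  let ?C = "conductor R"
  note R = assms(1)
  have C: "submod UNIV ?C" by (rule conductor_ideal[OF R])
  have dcc: "\<exists>m. \<forall>n\<ge>m. I n = I m"
    if "\<And>n. submod R (I n) \<and> ?C \<subseteq> I n \<and> I n \<subseteq> R \<and> I (Suc n) \<subseteq> I n" for I :: "nat \<Rightarrow> 'a set"
    by (rule artinian_nucleus_dcc[OF R]) (use assms(4) that in \<open>auto simp: gilmer_ext_def\<close>)
  have reg: "regular_mod R ?C"
  proof (rule dcc_reduced_regular_mod[OF R C])
    show "\<exists>m. \<forall>n\<ge>m. I n = I m"
      if "\<And>n. submod R (I n) \<and> ?C \<inter> R \<subseteq> I n \<and> I n \<subseteq> R \<and> I (Suc n) \<subseteq> I n" for I :: "nat \<Rightarrow> 'a set"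
      by (rule dcc) (use that in \<open>simp add: Int_absorb2[OF conductor_subset]\<close>)
    show "x \<in> ?C" if "x \<in> R" "x ^ n \<in> ?C" for x n
      by (rule reduced_nucleus_power[OF R assms(5) that])
  qed
  obtain \<epsilon> where sep: "\<And>s. diag s * \<epsilon> \<in> tens_rel R ?C"
    and unit: "(\<Sum>k\<in>Poly_Mapping.keys \<epsilon>. Poly_Mapping.lookup \<epsilon> k * unMul k) - 1 \<in> ?C"
    by (rule unramified_separability_element[OF R C assms(3)]) blast
  obtain F where "finite F" "mspan R (F \<union> ?C) = UNIV"
    by (rule separable_fin_gen[OF R C conductor_subset reg sep unit])
  then have "finite_ext R" by (rule finite_ext_if_mspan[OF R conductor_subset])
  moreover have "FIP R"
    by (rule separable_FIP[OF R C conductor_subset reg sep unit dcc])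
  ultimately show ?thesis ..
qed

end
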